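(* Let $M$ be a Frobenius manifold of even dimension $n=2k$, with metric $\eta$, whose Euler vector field has the form $$\partial_E=\sum_{\alpha=1}^kt^\alpha\frac{\partial}{\partial t^\alpha}+(1+2\mu)\sum_{\alpha=k+1}^nt^\alpha\frac{\partial}{\partial t^\alpha}$$ for some non-zero constant $\mu$. Let $\mathcal U=\partial_E\,\cdot$ be the operator of multiplication by the Euler vector field and $g^{\alpha\beta}=\eta^{\alpha\mu}\mathcal U^\beta_\mu$ the intersection form. Then the (contravariant) metric $$\tilde\eta^{\alpha\beta}=\eta^{\alpha\mu}(\mathcal U^2)^\beta_\mu$$ is flat and compatible with both $\eta$ and $g$.
   Context: A Frobenius manifold of dimension $n$ is given (locally) by a function $F(t^1,\dots,t^n)$ of complex variables and a constant symmetric nondegenerate matrix $(\eta_{\alpha\beta})$ with inverse $(\eta^{\alpha\beta})$ such that: $\partial_\alpha\cdot\partial_\beta=c_{\alpha\beta}^\gamma\partial_\gamma$, $c^\gamma_{\alpha\beta}=\eta^{\gamma\mu}\partial_\mu\partial_\alpha\partial_\beta F$, is an associative product of vector fields; $\partial_1\partial_\alpha\partial_\beta F=\eta_{\alpha\beta}$ (so $\partial_1$ is the unit); $\partial_EF=(3-d)F+$ quadratic polynomial for a constant $d$, where $\partial_E$ is the Euler vector field. No semisimplicity is assumed. $\mathcal U^\alpha_\beta=(\partial_E)^\mu c^\alpha_{\mu\beta}$. The contravariant metrics $g$ and $\tilde\eta$ are considered on the open set where $\mathcal U$ is invertible. Two contravariant metrics $g_1,g_2$ are compatible if they form a flat pencil: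 for generic $\epsilon$ the metric $g_1+\epsilon g_2$ is flat, and its contravariant Christoffel symbols are $\Gamma_1+\epsilon\Gamma_2$, where $\Gamma_i$ are the contravariant Christoffel symbols of $g_i$. The contravariant Christoffel symbols $\Gamma^{\alpha\beta}_\gamma$ of a contravariant metric $h^{\alpha\beta}$ are those of its Levi-Civita connection, uniquely characterized by $\partial_\gamma h^{\alpha\beta}=\Gamma^{\alpha\beta}_\gamma+\Gamma^{\beta\alpha}_\gamma$ and $h^{\alpha\nu}\Gamma^{\beta\gamma}_\nu=h^{\beta\nu}\Gamma^{\alpha\gamma}_\nu$. *)

theory Defs
  imports "HOL-Analysis.Analysis"
begin

unbundle no fps_syntax

definition holomorphic_vec_on :: "(complex^'n \<Rightarrow> complex) \<Rightarrow> (complex^'n) set \<Rightarrow> bool"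
  where "holomorphic_vec_on f D \<longleftrightarrow>
    (\<forall>t\<in>D. \<exists>a :: complex^'n. (f has_derivative (\<lambda>v. \<Sum>i\<in>UNIV. a $ i * v $ i)) (at t))"

definition pd :: "'n \<Rightarrow> (complex^'n \<Rightarrow> complex) \<Rightarrow> complex^'n \<Rightarrow> complex"
  where "pd i f t = deriv (\<lambda>z. f (t + z *s axis i 1)) 0"


section \<open>Contravariant metrics\<close>

definition contravariant_metric_on :: "(complex^'n) set \<Rightarrow> (complex^'n \<Rightarrow> complex^'n^'n) \<Rightarrow> bool"
  where "contravariant_metric_on S h \<longleftrightarrow>
    (\<forall>\<alpha> \<beta>. holomorphic_vec_on (\<lambda>t. h t $ \<alpha> $ \<beta>) S) \<and>
    (\<forall>t\<in>S. transpose (h t) = h t \<and> invertible (h t))"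

text \<open>An array \<open>\<Gamma> \<alpha> \<beta> \<gamma>\<close> stands for \<open>\<Gamma>\<^sup>\<alpha>\<^sup>\<beta>\<^sub>\<gamma>\<close>.\<close>

definition is_contravariant_christoffel ::
    "(complex^'n \<Rightarrow> complex^'n^'n) \<Rightarrow> complex^'n \<Rightarrow> ('n \<Rightarrow> 'n \<Rightarrow> 'n \<Rightarrow> complex) \<Rightarrow> bool"
  where "is_contravariant_christoffel h t \<Gamma> \<longleftrightarrow>
    (\<forall>\<alpha> \<beta> \<gamma>. pd \<gamma> (\<lambda>s. h s $ \<alpha> $ \<beta>) t = \<Gamma> \<alpha> \<beta> \<gamma> + \<Gamma> \<beta> \<alpha> \<gamma>) \<and>
    (\<forall>\<alpha> \<beta> \<gamma>. (\<Sum>\<nu>\<in>UNIV. h t $ \<alpha> $ \<nu> * \<Gamma> \<beta> \<gamma> \<nu>) = (\<Sum>\<nu>\<in>UNIV. h t $ \<beta> $ \<nu> * \<Gamma> \<alpha> \<gamma> \<nu>))"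

text \<open>The description is well defined at every point of an open set on which \<open>h\<close> is a
  contravariant metric; see \<open>ex1_contravariant_christoffel\<close> below.\<close>

definition contravariant_christoffel ::
    "(complex^'n \<Rightarrow> complex^'n^'n) \<Rightarrow> complex^'n \<Rightarrow> 'n \<Rightarrow> 'n \<Rightarrow> 'n \<Rightarrow> complex"
  where "contravariant_christoffel h t = (THE \<Gamma>. is_contravariant_christoffel h t \<Gamma>)"

text \<open>\<open>christoffel h t \<beta> \<mu> \<gamma>\<close> is \<open>\<Gamma>\<^sup>\<beta>\<^sub>\<mu>\<^sub>\<gamma>\<close>, the coefficient of the Levi-Civita connection
  recovered from \<open>\<Gamma>\<^sup>\<alpha>\<^sup>\<beta>\<^sub>\<gamma> = - h\<^sup>\<alpha>\<^sup>\<nu> \<Gamma>\<^sup>\<beta>\<^sub>\<nu>\<^sub>\<gamma>\<close>. The two conditions in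
  \<open>is_contravariant_christoffel\<close> then say that this connection preserves \<open>h\<close> and is torsion-free.\<close>

definition christoffel ::
    "(complex^'n \<Rightarrow> complex^'n^'n) \<Rightarrow> complex^'n \<Rightarrow> 'n \<Rightarrow> 'n \<Rightarrow> 'n \<Rightarrow> complex"
  where "christoffel h t \<beta> \<mu> \<gamma> =
    - (\<Sum>\<alpha>\<in>UNIV. matrix_inv (h t) $ \<mu> $ \<alpha> * contravariant_christoffel h t \<alpha> \<beta> \<gamma>)"

text \<open>\<open>curvature h t \<delta> \<gamma> \<alpha> \<beta>\<close> is the component along \<open>\<partial>\<^sub>\<delta>\<close> of \<open>R(\<partial>\<^sub>\<alpha>, \<partial>\<^sub>\<beta>) \<partial>\<^sub>\<gamma>\<close>.\<close>

definition curvature ::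
    "(complex^'n \<Rightarrow> complex^'n^'n) \<Rightarrow> complex^'n \<Rightarrow> 'n \<Rightarrow> 'n \<Rightarrow> 'n \<Rightarrow> 'n \<Rightarrow> complex"
  where "curvature h t \<delta> \<gamma> \<alpha> \<beta> =
    pd \<alpha> (\<lambda>s. christoffel h s \<delta> \<beta> \<gamma>) t - pd \<beta> (\<lambda>s. christoffel h s \<delta> \<alpha> \<gamma>) t +
    (\<Sum>\<nu>\<in>UNIV. christoffel h t \<delta> \<alpha> \<nu> * christoffel h t \<nu> \<beta> \<gamma>) -
    (\<Sum>\<nu>\<in>UNIV. christoffel h t \<delta> \<beta> \<nu> * christoffel h t \<nu> \<alpha> \<gamma>)"

definition flat_metric_on :: "(complex^'n) set \<Rightarrow> (complex^'n \<Rightarrow> complex^'n^'n) \<Rightarrow> bool"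
  where "flat_metric_on S h \<longleftrightarrow>
    contravariant_metric_on S h \<and> (\<forall>t\<in>S. \<forall>\<delta> \<gamma> \<alpha> \<beta>. curvature h t \<delta> \<gamma> \<alpha> \<beta> = 0)"

definition pencil ::
    "(complex^'n \<Rightarrow> complex^'n^'n) \<Rightarrow> (complex^'n \<Rightarrow> complex^'n^'n) \<Rightarrow> complex \<Rightarrow> complex^'n \<Rightarrow> complex^'n^'n"
  where "pencil h1 h2 \<epsilon> t = (\<chi> \<alpha> \<beta>. h1 t $ \<alpha> $ \<beta> + \<epsilon> * h2 t $ \<alpha> $ \<beta>)"

text \<open>For a fixed \<open>\<epsilon>\<close> the pencil may degenerate at some points of \<open>S\<close> (at the points where \<open>- \<epsilon>\<close>
  is an eigenvalue of \<open>h1\<close> relative to \<open>h2\<close>), and the values of \<open>\<epsilon>\<close> for which this happens may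
  fill an open set. Hence genericity of \<open>\<epsilon>\<close> is nondegeneracy: at each point all but finitely
  many \<open>\<epsilon>\<close> give a nondegenerate form, and for every \<open>\<epsilon>\<close> the requirements are imposed at all
  points where the form is nondegenerate.\<close>

definition compatible_metrics_on ::
    "(complex^'n) set \<Rightarrow> (complex^'n \<Rightarrow> complex^'n^'n) \<Rightarrow> (complex^'n \<Rightarrow> complex^'n^'n) \<Rightarrow> bool"
  where "compatible_metrics_on S h1 h2 \<longleftrightarrow>
    contravariant_metric_on S h1 \<and> contravariant_metric_on S h2 \<and>
    (\<forall>t \<in> S. finite {\<epsilon>. \<not> invertible (pencil h1 h2 \<epsilon> t)}) \<and>
    (\<forall>\<epsilon>. let S\<epsilon> = {t \<in> S. invertible (pencil h1 h2 \<epsilon> t)} in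
       flat_metric_on S\<epsilon> (pencil h1 h2 \<epsilon>) \<and>
       (\<forall>t\<in>S\<epsilon>. \<forall>\<alpha> \<beta> \<gamma>. contravariant_christoffel (pencil h1 h2 \<epsilon>) t \<alpha> \<beta> \<gamma> =
          contravariant_christoffel h1 t \<alpha> \<beta> \<gamma> + \<epsilon> * contravariant_christoffel h2 t \<alpha> \<beta> \<gamma>))"


section \<open>Frobenius manifolds in flat coordinates\<close>

text \<open>\<open>structure_const F \<eta> t \<gamma> \<alpha> \<beta>\<close> is \<open>c\<^sup>\<gamma>\<^sub>\<alpha>\<^sub>\<beta>\<close> at the point \<open>t\<close>.\<close>

definition structure_const ::
    "(complex^'n \<Rightarrow> complex) \<Rightarrow> complex^'n^'n \<Rightarrow> complex^'n \<Rightarrow> 'n \<Rightarrow> 'n \<Rightarrow> 'n \<Rightarrow> complex"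
  where "structure_const F \<eta> t \<gamma> \<alpha> \<beta> =
    (\<Sum>\<mu>\<in>UNIV. matrix_inv \<eta> $ \<gamma> $ \<mu> * pd \<mu> (pd \<alpha> (pd \<beta> F)) t)"

definition frob_mult ::
    "(complex^'n \<Rightarrow> complex) \<Rightarrow> complex^'n^'n \<Rightarrow> complex^'n \<Rightarrow> complex^'n \<Rightarrow> complex^'n \<Rightarrow> complex^'n"
  where "frob_mult F \<eta> t u v =
    (\<chi> \<gamma>. \<Sum>\<alpha>\<in>UNIV. \<Sum>\<beta>\<in>UNIV. structure_const F \<eta> t \<gamma> \<alpha> \<beta> * u $ \<alpha> * v $ \<beta>)"

text \<open>The arguments are the coordinate domain \<open>D\<close>, the potential \<open>F\<close>, the matrix \<open>\<eta>\<close> with lower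
  indices, the index \<open>e\<close> of the unit field, the Euler field \<open>E\<close>, and the charge \<open>d\<close>.\<close>

definition frobenius_manifold ::
    "(complex^'n) set \<Rightarrow> (complex^'n \<Rightarrow> complex) \<Rightarrow> complex^'n^'n \<Rightarrow> 'n \<Rightarrow>
     (complex^'n \<Rightarrow> complex^'n) \<Rightarrow> complex \<Rightarrow> bool"
  where "frobenius_manifold D F \<eta> e E d \<longleftrightarrow>
    open D \<and> holomorphic_vec_on F D \<and>
    transpose \<eta> = \<eta> \<and> invertible \<eta> \<and>
    (\<forall>t\<in>D. \<forall>u v w. frob_mult F \<eta> t (frob_mult F \<eta> t u v) w = frob_mult F \<eta> t u (frob_mult F \<eta> t v w)) \<and>
    (\<forall>t\<in>D. \<forall>\<alpha> \<beta>. pd e (pd \<alpha> (pd \<beta> F)) t = \<eta> $ \<alpha> $ \<beta>) \<and>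
    (\<exists>(a :: complex^'n^'n) (b :: complex^'n) c. \<forall>t\<in>D.
       (\<Sum>\<alpha>\<in>UNIV. E t $ \<alpha> * pd \<alpha> F t) = (3 - d) * F t +
         ((\<Sum>\<alpha>\<in>UNIV. \<Sum>\<beta>\<in>UNIV. a $ \<alpha> $ \<beta> * t $ \<alpha> * t $ \<beta>) + (\<Sum>\<alpha>\<in>UNIV. b $ \<alpha> * t $ \<alpha>) + c))"

text \<open>The entry in row \<open>\<alpha>\<close> and column \<open>\<beta>\<close> is \<open>U\<^sup>\<alpha>\<^sub>\<beta>\<close>, so the matrix acts on column vectors as
  multiplication by \<open>E t\<close>.\<close>

definition euler_mult ::
    "(complex^'n \<Rightarrow> complex) \<Rightarrow> complex^'n^'n \<Rightarrow> (complex^'n \<Rightarrow> complex^'n) \<Rightarrow> complex^'n \<Rightarrow> complex^'n^'n"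
  where "euler_mult F \<eta> E t =
    (\<chi> \<alpha> \<beta>. \<Sum>\<mu>\<in>UNIV. E t $ \<mu> * structure_const F \<eta> t \<alpha> \<mu> \<beta>)"

definition raise_metric :: "complex^'n^'n \<Rightarrow> (complex^'n \<Rightarrow> complex^'n^'n) \<Rightarrow> complex^'n \<Rightarrow> complex^'n^'n"
  where "raise_metric \<eta> A t = (\<chi> \<alpha> \<beta>. \<Sum>\<mu>\<in>UNIV. matrix_inv \<eta> $ \<alpha> $ \<mu> * A t $ \<beta> $ \<mu>)"

definition intersection_form ::
    "(complex^'n \<Rightarrow> complex) \<Rightarrow> complex^'n^'n \<Rightarrow> (complex^'n \<Rightarrow> complex^'n) \<Rightarrow> complex^'n \<Rightarrow> complex^'n^'n"
  where "intersection_form F \<eta> E = raise_metric \<eta> (euler_mult F \<eta> E)"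

definition eta_tilde ::
    "(complex^'n \<Rightarrow> complex) \<Rightarrow> complex^'n^'n \<Rightarrow> (complex^'n \<Rightarrow> complex^'n) \<Rightarrow> complex^'n \<Rightarrow> complex^'n^'n"
  where "eta_tilde F \<eta> E = raise_metric \<eta> (\<lambda>t. euler_mult F \<eta> E t ** euler_mult F \<eta> E t)"


section \<open>Well-definedness of the contravariant Christoffel symbols\<close>

lemma contravariant_metric_cancel:
  fixes H :: "complex^'n^'n"
  assumes "invertible H" and "\<And>\<alpha>. (\<Sum>\<nu>\<in>UNIV. H $ \<alpha> $ \<nu> * x \<nu>) = (\<Sum>\<nu>\<in>UNIV. H $ \<alpha> $ \<nu> * y \<nu>)"
  shows "x \<nu> = y \<nu>"
proof -
  have "H *v (\<chi> i. x i) = H *v (\<chi> i. y i)"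
    using assms(2) by (simp add: vec_eq_iff matrix_vector_mult_def)
  then have "(\<chi> i. x i) = (\<chi> i. y i)"
    using inj_matrix_vector_mult[OF assms(1)] by (simp add: inj_eq)
  then show ?thesis by (simp add: vec_eq_iff)
qed

lemma pd_cong_open:
  assumes "open S" "t \<in> S" "\<And>s. s \<in> S \<Longrightarrow> f s = g s"
  shows "pd i f t = pd i g t"
proof -
  have "((\<lambda>z. t + z *s axis i 1) \<longlongrightarrow> t + 0 *s axis i 1) (at (0::complex))"
    unfolding vector_scalar_mult_def by (intro tendsto_intros)
  then have "\<forall>\<^sub>F z in nhds 0. t + z *s axis i 1 \<in> S"
    using assms(1,2) topological_tendstoD[of _ _ _ S] by (simp add: eventually_nhds_conv_at)
  then have "\<forall>\<^sub>F z in nhds 0. f (t + z *s axis i 1) = g (t + z *s axis i 1)"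
    by (rule eventually_mono) (use assms(3) in auto)
  then show ?thesis unfolding pd_def by (rule deriv_cong_ev) simp
qed

lemma ex1_contravariant_christoffel:
  assumes S: "open S" "t \<in> S" and h: "contravariant_metric_on S h"
  shows "\<exists>!\<Gamma>. is_contravariant_christoffel h t \<Gamma>"
proof -
  define H where "H = h t"
  define G where "G = matrix_inv H"
  define A where "A \<alpha> \<beta> \<gamma> = (\<Sum>\<nu>\<in>UNIV. H $ \<alpha> $ \<nu> * pd \<nu> (\<lambda>s. h s $ \<beta> $ \<gamma>) t)" for \<alpha> \<beta> \<gamma>
  define \<Gamma>0 where "\<Gamma>0 \<beta> \<gamma> \<nu> = (\<Sum>\<alpha>\<in>UNIV. G $ \<nu> $ \<alpha> * ((A \<alpha> \<beta> \<gamma> + A \<beta> \<alpha> \<gamma> - A \<gamma> \<alpha> \<beta>) / 2))"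
    for \<beta> \<gamma> \<nu>
  have inv: "invertible H" using h S by (simp add: contravariant_metric_on_def H_def)
  have "h s $ \<alpha> $ \<beta> = h s $ \<beta> $ \<alpha>" if "s \<in> S" for s \<alpha> \<beta>
  proof -
    have "transpose (h s) = h s" using h that by (simp add: contravariant_metric_on_def)
    then have "transpose (h s) $ \<alpha> $ \<beta> = h s $ \<alpha> $ \<beta>" by simp
    then show ?thesis by (simp add: transpose_def)
  qed
  then have sym: "pd \<gamma> (\<lambda>s. h s $ \<alpha> $ \<beta>) t = pd \<gamma> (\<lambda>s. h s $ \<beta> $ \<alpha>) t" for \<alpha> \<beta> \<gamma>
    by (intro pd_cong_open[OF S]) auto
  then have Asym: "A \<alpha> \<beta> \<gamma> = A \<alpha> \<gamma> \<beta>" for \<alpha> \<beta> \<gamma> unfolding A_def by simp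
  have HG: "H ** G = mat 1"
    using someI_ex[OF inv[unfolded invertible_def]] unfolding G_def matrix_inv_def by simp
  have contr: "(\<Sum>\<nu>\<in>UNIV. H $ \<alpha> $ \<nu> * (\<Sum>\<kappa>\<in>UNIV. G $ \<nu> $ \<kappa> * x \<kappa>)) = x \<alpha>" for \<alpha> x
  proof -
    have "H *v (G *v (\<chi> i. x i)) = (\<chi> i. x i)"
      by (simp add: matrix_vector_mul_assoc HG)
    then show ?thesis by (simp add: vec_eq_iff matrix_vector_mult_def)
  qed
  have T0: "(\<Sum>\<nu>\<in>UNIV. H $ \<alpha> $ \<nu> * \<Gamma>0 \<beta> \<gamma> \<nu>) = (A \<alpha> \<beta> \<gamma> + A \<beta> \<alpha> \<gamma> - A \<gamma> \<alpha> \<beta>) / 2" for \<alpha> \<beta> \<gamma>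
    unfolding \<Gamma>0_def by (rule contr)
  show ?thesis
  proof (rule ex1I[of _ \<Gamma>0])
    have "pd \<gamma> (\<lambda>s. h s $ \<alpha> $ \<beta>) t = \<Gamma>0 \<alpha> \<beta> \<gamma> + \<Gamma>0 \<beta> \<alpha> \<gamma>" for \<alpha> \<beta> \<gamma>
    proof (rule contravariant_metric_cancel[OF inv])
      fix \<kappa>
      have "(\<Sum>\<nu>\<in>UNIV. H $ \<kappa> $ \<nu> * (\<Gamma>0 \<alpha> \<beta> \<nu> + \<Gamma>0 \<beta> \<alpha> \<nu>)) = A \<kappa> \<alpha> \<beta>"
        unfolding distrib_left sum.distrib T0 by (simp add: Asym[of \<kappa> \<beta> \<alpha>] field_simps)
      then show "(\<Sum>\<nu>\<in>UNIV. H $ \<kappa> $ \<nu> * pd \<nu> (\<lambda>s. h s $ \<alpha> $ \<beta>) t) =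
          (\<Sum>\<nu>\<in>UNIV. H $ \<kappa> $ \<nu> * (\<Gamma>0 \<alpha> \<beta> \<nu> + \<Gamma>0 \<beta> \<alpha> \<nu>))"
        by (simp add: A_def)
    qed
    moreover have "(\<Sum>\<nu>\<in>UNIV. H $ \<alpha> $ \<nu> * \<Gamma>0 \<beta> \<gamma> \<nu>) = (\<Sum>\<nu>\<in>UNIV. H $ \<beta> $ \<nu> * \<Gamma>0 \<alpha> \<gamma> \<nu>)"
      for \<alpha> \<beta> \<gamma>
      unfolding T0 using Asym[of \<gamma> \<alpha> \<beta>] by simp
    ultimately show "is_contravariant_christoffel h t \<Gamma>0"
      unfolding is_contravariant_christoffel_def H_def by blast
  next
    fix \<Gamma> assume G: "is_contravariant_christoffel h t \<Gamma>"
    define T where "T \<alpha> \<beta> \<gamma> = (\<Sum>\<nu>\<in>UNIV. H $ \<alpha> $ \<nu> * \<Gamma> \<beta> \<gamma> \<nu>)" for \<alpha> \<beta> \<gamma>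
    have T1: "T \<alpha> \<beta> \<gamma> = T \<beta> \<alpha> \<gamma>" for \<alpha> \<beta> \<gamma>
      using G unfolding T_def H_def is_contravariant_christoffel_def by blast
    have T2: "A \<alpha> \<beta> \<gamma> = T \<alpha> \<beta> \<gamma> + T \<alpha> \<gamma> \<beta>" for \<alpha> \<beta> \<gamma>
      using G unfolding T_def A_def is_contravariant_christoffel_def
      by (simp add: distrib_left sum.distrib)
    have "T \<alpha> \<beta> \<gamma> = (A \<alpha> \<beta> \<gamma> + A \<beta> \<alpha> \<gamma> - A \<gamma> \<alpha> \<beta>) / 2" for \<alpha> \<beta> \<gamma>
      unfolding T2 T1[of \<gamma> \<alpha> \<beta>] T1[of \<gamma> \<beta> \<alpha>] T1[of \<beta> \<alpha> \<gamma>] by simp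
    then have "\<Gamma> \<beta> \<gamma> \<nu> = \<Gamma>0 \<beta> \<gamma> \<nu>" for \<beta> \<gamma> \<nu>
      using contravariant_metric_cancel[OF inv, of "\<Gamma> \<beta> \<gamma>" "\<Gamma>0 \<beta> \<gamma>" \<nu>] unfolding T0 T_def by blast
    then show "\<Gamma> = \<Gamma>0" by (intro ext)
  qed
qed

end

theory Submission
  imports Defs "HOL-Complex_Analysis.Cauchy_Integral_Formula"
    "HOL-Computational_Algebra.Polynomial"
begin

text \<open>Let \<open>H = \<eta>\<^sup>-\<^sup>1\<close>, let \<open>C\<^sub>\<gamma>\<close> be multiplication by \<open>\<partial>\<^sub>\<gamma>\<close> and \<open>U\<close> multiplication by the Euler field.
  Nondegeneracy of \<open>\<eta>\<close> forces \<open>d = - 2 \<mu>\<close>, and homogeneity reads \<open>\<partial>\<^sub>\<gamma> U = C\<^sub>\<gamma> + [C\<^sub>\<gamma>, P]\<close> with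
  \<open>P = diag (\<mu>, \<dots>, \<mu>, - \<mu>, \<dots>, - \<mu>)\<close>, which is anti-selfadjoint for \<open>\<eta>\<close>; the special form of the Euler
  field enters through \<open>P\<^sup>2 = \<mu>\<^sup>2\<close>.
  All metrics in question and their pencils have the form \<open>L H\<close> with \<open>L = a U\<^sup>2 + b U + c\<close>. The matrices
  \<open>\<Gamma>\<^sub>\<gamma> = C\<^sub>\<gamma> Y H\<close>, \<open>Y = a (U + U P + P U) + b (1/2 + P)\<close>, are the contravariant Christoffel
  symbols of \<open>L H\<close>, and they are linear in \<open>(a, b, c)\<close>. With \<open>Q\<close> the adjoint of \<open>Y\<close>, the connection
  matrices are \<open>A\<^sub>\<gamma> = - Q L\<^sup>-\<^sup>1 C\<^sub>\<gamma>\<close>. Since \<open>\<partial>\<^sub>\<gamma> L = C\<^sub>\<gamma> Y + Q C\<^sub>\<gamma>\<close>, where \<open>Y + Q\<close> is a polynomial in \<open>U\<close>,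
  and since \<open>P\<^sup>2\<close> is scalar, so that \<open>\<partial>\<^sub>\<gamma> Q = a (1 - 2 P) C\<^sub>\<gamma>\<close>, all terms of the curvature cancel.\<close>

subsection \<open>Holomorphic functions of several complex variables\<close>

lemma scalar_mult_axis: "z *s axis i 1 = (axis i z :: complex^'n)"
  by (simp add: vec_eq_iff axis_def)

lemma norm_axis: "norm (axis i z :: complex^'n) = norm z"
  by (simp add: norm_eq_sqrt_inner inner_axis_axis)

lemma bounded_linear_axis: "bounded_linear (axis i :: complex \<Rightarrow> complex^'n)"
  unfolding linear_conv_bounded_linear[symmetric]
  by (rule linearI) (simp_all add: vec_eq_iff axis_def)

text \<open>\<open>has_derivative\<close> is a real notion; because the derivative is a complex
  linear form, its restriction to the complex line in direction \<open>i\<close> is multiplication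
  by \<open>a $ i\<close>, hence a complex derivative.\<close>

lemma has_derivative_imp_line_derivative:
  fixes f :: "complex^'n \<Rightarrow> complex"
  assumes "(f has_derivative (\<lambda>v. \<Sum>j\<in>UNIV. a $ j * v $ j)) (at (t + w *s axis i 1))"
  shows "((\<lambda>z. f (t + z *s axis i 1)) has_field_derivative a $ i) (at w)"
proof -
  have "((\<lambda>z. t + z *s axis i (1::complex)) has_derivative (\<lambda>z. z *s axis i 1)) (at w)"
    unfolding scalar_mult_axis
    by (auto intro!: derivative_eq_intros bounded_linear_imp_has_derivative bounded_linear_axis)
  from has_derivative_compose[OF this assms]
  have "((\<lambda>z. f (t + z *s axis i 1)) has_derivative (\<lambda>z. \<Sum>j\<in>UNIV. a $ j * (z *s axis i 1) $ j)) (at w)" .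
  also have "(\<lambda>z. \<Sum>j\<in>UNIV. a $ j * (z *s axis i 1) $ j) = (*) (a $ i)"
    by (simp add: fun_eq_iff axis_def if_distrib cong: if_cong)
  finally show ?thesis by (simp only: has_field_derivative_def)
qed

lemma has_derivative_imp_pd:
  assumes "(f has_derivative (\<lambda>v. \<Sum>j\<in>UNIV. a $ j * v $ j)) (at t)"
  shows "pd i f t = a $ i"
  using has_derivative_imp_line_derivative[of f a t 0 i] assms
  by (simp add: pd_def DERIV_imp_deriv)

lemma holomorphic_vec_has_derivative:
  assumes "holomorphic_vec_on f D" "t \<in> D"
  shows "(f has_derivative (\<lambda>v. \<Sum>j\<in>UNIV. pd j f t * v $ j)) (at t)"
  using assms has_derivative_imp_pd unfolding holomorphic_vec_on_def by fastforce

lemma holomorphic_vec_line_derivative: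
  assumes "holomorphic_vec_on f D" "t + w *s axis i 1 \<in> D"
  shows "((\<lambda>z. f (t + z *s axis i 1)) has_field_derivative pd i f (t + w *s axis i 1)) (at w)"
  using has_derivative_imp_line_derivative[of f "\<chi> j. pd j f (t + w *s axis i 1)"]
    holomorphic_vec_has_derivative[OF assms] by simp

lemma holomorphic_vec_continuous_on: "holomorphic_vec_on f D \<Longrightarrow> continuous_on D f"
  unfolding holomorphic_vec_on_def
  by (meson continuous_at_imp_continuous_on has_derivative_continuous)

text \<open>Cauchy's formula for the first derivative on a circle in one coordinate line,
  parametrised over a fixed real interval so that the dependence on \<open>t\<close> can be studied
  under the integral sign.\<close>

lemma pd_eq_integral:
  assumes f: "holomorphic_vec_on f D" and r: "r > 0"
    and D: "\<And>z. norm z \<le> r \<Longrightarrow> t + z *s axis i 1 \<in> D"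
  shows "pd i f t = integral {0..1}
    (\<lambda>x. f (t + (of_real r * exp (2 * of_real pi * \<i> * of_real x)) *s axis i 1) *
      (1 / (of_real r * exp (2 * of_real pi * \<i> * of_real x))))"
proof -
  let ?g = "\<lambda>z. f (t + z *s axis i 1)"
  have der: "(?g has_field_derivative pd i f (t + w *s axis i 1)) (at w)" if "norm w \<le> r" for w
    using holomorphic_vec_line_derivative[OF f] D that by blast
  have 1: "continuous_on (cball 0 r) ?g"
    by (rule DERIV_continuous_on[of _ _ "\<lambda>w. pd i f (t + w *s axis i 1)"])
       (auto intro: DERIV_subset der)
  have 2: "?g holomorphic_on ball 0 r"
    unfolding holomorphic_on_def field_differentiable_def
    by (metis DERIV_subset der dist_0_norm less_imp_le mem_ball subset_UNIV)
  have "pd i f t = 1 / (2 * of_real pi * \<i>) * contour_integral (circlepath 0 r) (\<lambda>u. ?g u / u^2)"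
    using Cauchy_derivative_integral_circlepath(2)[OF 1 2, of 0] r
    by (simp add: pd_def DERIV_imp_deriv)
  also have "contour_integral (circlepath 0 r) (\<lambda>u. ?g u / u^2) = 
    integral {0..1} (\<lambda>x. (2 * of_real pi * \<i>) *
     (?g (of_real r * exp (2 * of_real pi * \<i> * of_real x)) *
      (1 / (of_real r * exp (2 * of_real pi * \<i> * of_real x)))))"
    unfolding contour_integral_integral vector_derivative_circlepath
    using r by (intro integral_cong) (simp add: circlepath power2_eq_square field_simps)
  finally show ?thesis by (simp only: integral_mult_right) simp
qed

text \<open>One radius serves all base points near \<open>t0\<close> and all directions, so the
  Cauchy integral with this \<open>r\<close> represents \<open>pd i f\<close> on a whole
  ball.\<close>

lemma shifted_circle_subset:
  fixes t0 :: "complex^'n"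
  assumes "open D" "t0 \<in> D"
  obtains r where "r > 0"
    and "\<And>t z i. t \<in> ball t0 r \<Longrightarrow> norm z \<le> r \<Longrightarrow> t + z *s axis i 1 \<in> D"
proof -
  obtain e where e: "e > 0" "ball t0 e \<subseteq> D"
    using assms open_contains_ball by blast
  have "t + z *s axis i 1 \<in> D" if "t \<in> ball t0 (e/2)" "norm z \<le> e/2" for t :: "complex^'n" and z i
  proof -
    have "norm (t - t0 + z *s axis i 1) < e"
      using that norm_triangle_ineq[of "t - t0" "axis i z"]
      by (simp add: scalar_mult_axis norm_axis dist_norm norm_minus_commute)
    then have "t + z *s axis i 1 \<in> ball t0 e"
      by (simp add: dist_norm norm_minus_commute algebra_simps)
    with e show ?thesis by blast
  qed
  then show thesis using that[of "e/2"] e by simp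
qed

text \<open>Joint continuity of the Cauchy integrand, as required for integrals depending on a
  parameter.\<close>

lemma continuous_on_circle_shift:
  fixes f :: "complex^'n \<Rightarrow> complex"
  assumes f: "continuous_on D f" and r: "r > 0"
    and D: "\<And>t z. t \<in> U \<Longrightarrow> norm z \<le> r \<Longrightarrow> t + z *s axis i 1 \<in> D"
  shows "continuous_on (U \<times> {0..1::real})
    (\<lambda>(t, x). f (t + (of_real r * exp (2 * of_real pi * \<i> * of_real x)) *s axis i 1) *
      (1 / (of_real r * exp (2 * of_real pi * \<i> * of_real x))))"
proof -
  have "continuous_on (U \<times> {0..1})
      (\<lambda>p. fst p + (of_real r * exp (2 * of_real pi * \<i> * of_real (snd p :: real))) *s axis i 1 :: complex^'n)"
    unfolding vector_scalar_mult_def by (intro continuous_intros)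
  then have "continuous_on (U \<times> {0..1})
      (\<lambda>p. f (fst p + (of_real r * exp (2 * of_real pi * \<i> * of_real (snd p :: real))) *s axis i 1))"
    by (rule continuous_on_compose2[OF f]) (use D r in \<open>auto simp: norm_mult\<close>)
  then show ?thesis
    unfolding split_beta using r by (intro continuous_intros) auto
qed

text \<open>\<open>holomorphic_vec_on\<close> asks only for pointwise differentiability; continuity
  of the partial derivatives, on which differentiation under the integral relies, comes from the
  Cauchy integral.\<close>

lemma continuous_on_pd:
  fixes f :: "complex^'n \<Rightarrow> complex"
  assumes D: "open D" and f: "holomorphic_vec_on f D"
  shows "continuous_on D (pd i f)"
proof (rule continuous_at_imp_continuous_on, rule ballI)
  fix t0 assume "t0 \<in> D"
  then obtain r where r: "r > 0"
    and rD: "\<And>t z i. t \<in> ball t0 r \<Longrightarrow> norm z \<le> r \<Longrightarrow> t + z *s axis i 1 \<in> D"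
    using shifted_circle_subset[OF D] by blast
  have "continuous_on (ball t0 r) (\<lambda>t. integral (cbox 0 1)
    (\<lambda>x. f (t + (of_real r * exp (2 * of_real pi * \<i> * of_real x)) *s axis i 1) *
      (1 / (of_real r * exp (2 * of_real pi * \<i> * of_real x)))))"
    using continuous_on_circle_shift[OF holomorphic_vec_continuous_on[OF f] r rD, of "ball t0 r"]
    by (intro integral_continuous_on_param) simp
  then have "continuous_on (ball t0 r) (pd i f)"
    by (rule continuous_on_eq) (use pd_eq_integral[OF f r rD] in simp)
  then show "isCont (pd i f) t0"
    using r by (simp add: continuous_on_eq_continuous_at)
qed

text \<open>Cauchy's integral formula on a circle in the direction \<open>i\<close> reduces regularity of
  \<open>pd i f\<close> to differentiation under the integral sign.\<close>

proposition holomorphic_vec_pd: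
  fixes f :: "complex^'n \<Rightarrow> complex"
  assumes D: "open D" and f: "holomorphic_vec_on f D"
  shows "holomorphic_vec_on (pd i f) D"
    and "t \<in> D \<Longrightarrow> pd j (pd i f) t = pd i (pd j f) t"
proof -
  \<comment> \<open>The derivative of \<open>pd i f\<close> along \<open>j\<close> is a Cauchy
    integral of \<open>pd j f\<close> in direction \<open>i\<close>, hence equals
    \<open>pd i (pd j f)\<close>. The second conjunct is conditional because holomorphy of
    \<open>pd j f\<close> is obtained only afterwards, from the first.\<close>
  have main: "\<exists>a. (pd i f has_derivative (\<lambda>v. \<Sum>j\<in>UNIV. a $ j * v $ j)) (at t0) \<and>
      (\<forall>j. holomorphic_vec_on (pd j f) D \<longrightarrow> pd i (pd j f) t0 = a $ j)"
    if "t0 \<in> D" for t0 i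
  proof -
    obtain r where r: "r > 0"
      and rD: "\<And>t z i. t \<in> ball t0 r \<Longrightarrow> norm z \<le> r \<Longrightarrow> t + z *s axis i 1 \<in> D"
      using shifted_circle_subset[OF D \<open>t0 \<in> D\<close>] by blast
    define \<omega> where "\<omega> x = of_real r * exp (2 * of_real pi * \<i> * of_real x)" for x :: real
    define K where "K j t x = pd j f (t + \<omega> x *s axis i 1) * (1 / \<omega> x)" for j t x
    \<comment> \<open>The derivative of the integrand as a bounded linear operator, the form in
      which \<open>leibniz_rule\<close> expects it.\<close>
    define L where "L t x = (\<Sum>j\<in>UNIV. blinfun_mult_right (K j t x) o\<^sub>L Blinfun (\<lambda>v. v $ j))"
      for t :: "complex^'n" and x
    define J where "J t = integral (cbox 0 1) (\<lambda>x. f (t + \<omega> x *s axis i 1) * (1 / \<omega> x))" for t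
    have \<omega>: "norm (\<omega> x) \<le> r" "\<omega> x \<noteq> 0" for x
      using r by (auto simp: \<omega>_def norm_mult)
    have K: "continuous_on (ball t0 r \<times> {0..1}) (\<lambda>(t, x). K j t x)" for j
      using continuous_on_circle_shift[OF continuous_on_pd[OF D f] r rD]
      unfolding K_def \<omega>_def .
    have Kx: "K j t0 integrable_on {0..1}" for j
      by (rule integrable_continuous_real, rule continuous_on_compose2[OF K, of _ "\<lambda>x. (t0, x)", simplified])
         (use r in \<open>auto intro!: continuous_intros\<close>)
    have nth: "blinfun_apply (Blinfun (\<lambda>v::complex^'n. v $ j)) v = v $ j" for j v
      by (rule bounded_linear_Blinfun_apply[THEN fun_cong]) (rule bounded_linear_vec_nth)
    have L: "blinfun_apply (L t x) v = (\<Sum>j\<in>UNIV. K j t x * v $ j)" for t x v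
      by (simp add: L_def blinfun.sum_left nth)
    have cL: "continuous_on (ball t0 r \<times> cbox 0 1) (\<lambda>(t, x). L t x)"
      using K unfolding L_def split_beta by (intro continuous_intros) auto
    have "(J has_derivative integral (cbox 0 1) (L t0)) (at t0 within ball t0 r)"
      unfolding J_def
    proof (rule leibniz_rule[OF _ _ cL])
      fix t and x :: real assume t: "t \<in> ball t0 r"
      have "((\<lambda>t. f (t + \<omega> x *s axis i 1)) has_derivative
          (\<lambda>v. \<Sum>j\<in>UNIV. pd j f (t + \<omega> x *s axis i 1) * v $ j)) (at t)"
        by (rule has_derivative_compose[where f="\<lambda>t. t + \<omega> x *s axis i 1" and f'="\<lambda>v. v"],
            auto intro!: derivative_eq_intros holomorphic_vec_has_derivative[OF f] rD t \<omega>)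
      then have "((\<lambda>t. f (t + \<omega> x *s axis i 1) * (1 / \<omega> x)) has_derivative
          (\<lambda>v. (\<Sum>j\<in>UNIV. pd j f (t + \<omega> x *s axis i 1) * v $ j) * (1 / \<omega> x))) (at t)"
        by (rule has_derivative_mult_left)
      also have "(\<lambda>v. (\<Sum>j\<in>UNIV. pd j f (t + \<omega> x *s axis i 1) * v $ j) * (1 / \<omega> x)) = blinfun_apply (L t x)"
        by (simp add: fun_eq_iff L K_def sum_distrib_right sum_divide_distrib mult_ac)
      finally show "((\<lambda>t. f (t + \<omega> x *s axis i 1) * (1 / \<omega> x)) has_derivative blinfun_apply (L t x))
         (at t within ball t0 r)"
        by (rule has_derivative_at_withinI)
    next
      fix t assume t: "t \<in> ball t0 r"
      have Pt: "continuous_on {0..1} (Pair t)" "Pair t ` {0..1::real} \<subseteq> ball t0 r \<times> {0..1}"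
        using t by (auto intro!: continuous_intros)
      have "continuous_on {0..1} (\<lambda>x. f (t + \<omega> x *s axis i 1) * (1 / \<omega> x))"
        using continuous_on_compose2[OF continuous_on_circle_shift[OF
            holomorphic_vec_continuous_on[OF f] r rD, folded \<omega>_def, of "ball t0 r" i] Pt]
        unfolding prod.case by - assumption
      then show "(\<lambda>x. f (t + \<omega> x *s axis i 1) * (1 / \<omega> x)) integrable_on cbox 0 1"
        by (simp add: integrable_continuous_real)
    qed (use r in auto)
    moreover have "at t0 within ball t0 r = at t0"
      using r by (intro at_within_open) auto
    ultimately have "(J has_derivative integral (cbox 0 1) (L t0)) (at t0)"
      by (simp only:)
    moreover have "L t0 integrable_on cbox 0 1"
      by (rule integrable_continuous, rule continuous_on_compose2[OF cL, of _ "\<lambda>x. (t0, x)", simplified])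
         (use r in \<open>auto intro!: continuous_intros\<close>)
    then have "blinfun_apply (integral (cbox 0 1) (L t0)) =
      (\<lambda>v. \<Sum>j\<in>UNIV. (\<chi> j. integral {0..1} (K j t0)) $ j * v $ j)"
      by (simp add: fun_eq_iff blinfun_apply_integral L integral_sum integrable_on_mult_left Kx)
    ultimately have "(J has_derivative (\<lambda>v. \<Sum>j\<in>UNIV. (\<chi> j. integral {0..1} (K j t0)) $ j * v $ j)) (at t0)"
      by (simp only:)
    then have "(pd i f has_derivative (\<lambda>v. \<Sum>j\<in>UNIV. (\<chi> j. integral {0..1} (K j t0)) $ j * v $ j)) (at t0)"
      by (rule has_derivative_transform_within_open[of _ _ _ _ "ball t0 r"])
         (use r pd_eq_integral[OF f r rD] in \<open>auto simp: J_def \<omega>_def\<close>)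
    moreover have "pd i (pd j f) t0 = integral {0..1} (K j t0)" if "holomorphic_vec_on (pd j f) D" for j
      using pd_eq_integral[OF that r rD, of t0 i] r unfolding K_def \<omega>_def by simp
    ultimately show ?thesis by (intro exI[of _ "\<chi> j. integral {0..1} (K j t0)"]) auto
  qed
  have hol: "holomorphic_vec_on (pd i f) D" for i
    unfolding holomorphic_vec_on_def using main by blast
  then show "holomorphic_vec_on (pd i f) D" .
  show "pd j (pd i f) t = pd i (pd j f) t" if "t \<in> D"
    using main[OF that, of i] hol has_derivative_imp_pd by metis
qed

subsection \<open>Complex matrices and their partial derivatives\<close>

lemma holomorphic_vec_on_const: "holomorphic_vec_on (\<lambda>t. c) D"
  unfolding holomorphic_vec_on_def by (intro ballI exI[of _ 0]) simp

lemma holomorphic_vec_on_add: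
  assumes "holomorphic_vec_on f D" "holomorphic_vec_on g D"
  shows "holomorphic_vec_on (\<lambda>t. f t + g t) D"
  unfolding holomorphic_vec_on_def
proof
  fix t assume "t \<in> D"
  then have "((\<lambda>t. f t + g t) has_derivative
      (\<lambda>v. (\<Sum>j\<in>UNIV. pd j f t * v $ j) + (\<Sum>j\<in>UNIV. pd j g t * v $ j))) (at t)"
    by (intro has_derivative_add holomorphic_vec_has_derivative[OF assms(1)]
        holomorphic_vec_has_derivative[OF assms(2)])
  then show "\<exists>a. ((\<lambda>t. f t + g t) has_derivative (\<lambda>v. \<Sum>j\<in>UNIV. a $ j * v $ j)) (at t)"
    by (intro exI[of _ "\<chi> j. pd j f t + pd j g t"]) (simp add: distrib_right sum.distrib)
qed

lemma holomorphic_vec_on_mult: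
  assumes "holomorphic_vec_on f D" "holomorphic_vec_on g D"
  shows "holomorphic_vec_on (\<lambda>t. f t * g t) D"
  unfolding holomorphic_vec_on_def
proof
  fix t assume "t \<in> D"
  then have "((\<lambda>t. f t * g t) has_derivative
      (\<lambda>v. f t * (\<Sum>j\<in>UNIV. pd j g t * v $ j) + (\<Sum>j\<in>UNIV. pd j f t * v $ j) * g t)) (at t)"
    by (intro has_derivative_mult holomorphic_vec_has_derivative[OF assms(1)]
        holomorphic_vec_has_derivative[OF assms(2)])
  then show "\<exists>a. ((\<lambda>t. f t * g t) has_derivative (\<lambda>v. \<Sum>j\<in>UNIV. a $ j * v $ j)) (at t)"
    by (intro exI[of _ "\<chi> j. f t * pd j g t + pd j f t * g t"])
       (simp add: algebra_simps sum.distrib sum_distrib_left)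
qed

lemma holomorphic_vec_on_sum:
  assumes "\<And>i. i \<in> I \<Longrightarrow> holomorphic_vec_on (f i) D"
  shows "holomorphic_vec_on (\<lambda>t. \<Sum>i\<in>I. f i t) D"
  using assms by (induction I rule: infinite_finite_induct)
    (auto simp: holomorphic_vec_on_const intro!: holomorphic_vec_on_add)

lemma holomorphic_vec_on_nth: "holomorphic_vec_on (\<lambda>t. t $ i) D"
  unfolding holomorphic_vec_on_def
proof
  fix t assume "t \<in> D"
  have "((\<lambda>t. t $ i) has_derivative (\<lambda>v. v $ i)) (at t)"
    by (rule bounded_linear_imp_has_derivative) (rule bounded_linear_vec_nth)
  then show "\<exists>a. ((\<lambda>t. t $ i) has_derivative (\<lambda>v. \<Sum>j\<in>UNIV. a $ j * v $ j)) (at t)"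
    by (intro exI[of _ "axis i 1"]) (simp add: axis_def if_distrib[of "\<lambda>x. x * _"] cong: if_cong)
qed

lemma holomorphic_vec_on_subset: "holomorphic_vec_on f D \<Longrightarrow> S \<subseteq> D \<Longrightarrow> holomorphic_vec_on f S"
  unfolding holomorphic_vec_on_def by blast

lemmas holomorphic_vec_intros = holomorphic_vec_on_const holomorphic_vec_on_add
  holomorphic_vec_on_mult holomorphic_vec_on_sum holomorphic_vec_on_nth

section \<open>Matrix algebra over the complex numbers\<close>

lemma matrix_add_rdistrib: "(A + B) ** C = A ** C + B ** (C :: 'a::ring_1^'n^'n)"
  by (simp add: matrix_matrix_mult_def vec_eq_iff sum.distrib algebra_simps)
lemma matrix_minus_ldistrib: "A ** (B - C) = A ** B - A ** (C :: 'a::ring_1^'n^'n)"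
  by (simp add: matrix_matrix_mult_def vec_eq_iff sum_subtractf algebra_simps)
lemma matrix_minus_rdistrib: "(A - B) ** C = A ** C - B ** (C :: 'a::ring_1^'n^'n)"
  by (simp add: matrix_matrix_mult_def vec_eq_iff sum_subtractf algebra_simps)
lemma matrix_uminus_left: "(- A) ** B = - (A ** (B :: 'a::ring_1^'n^'n))"
  by (simp add: matrix_matrix_mult_def vec_eq_iff sum_negf)
lemma matrix_uminus_right: "A ** (- B) = - (A ** (B :: 'a::ring_1^'n^'n))"
  by (simp add: matrix_matrix_mult_def vec_eq_iff sum_negf)

definition cscale :: "complex \<Rightarrow> complex^'n^'n \<Rightarrow> complex^'n^'n"
  where "cscale a A = (\<chi> i j. a * A $ i $ j)"

lemma cscale_nth [simp]: "cscale a A $ i $ j = a * A $ i $ j"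
  by (simp add: cscale_def)

lemma cscale_mult_left: "cscale a A ** B = cscale a (A ** B)"
  by (simp add: matrix_matrix_mult_def vec_eq_iff sum_distrib_left mult_ac)
lemma cscale_mult_right: "A ** cscale a B = cscale a (A ** B)"
  by (simp add: matrix_matrix_mult_def vec_eq_iff sum_distrib_left mult_ac)
lemma cscale_add: "cscale a (A + B) = cscale a A + cscale a B"
  by (simp add: vec_eq_iff algebra_simps)
lemma cscale_diff: "cscale a (A - B) = cscale a A - cscale a B"
  by (simp add: vec_eq_iff algebra_simps)
lemma cscale_uminus: "cscale a (- A) = - cscale a A"
  by (simp add: vec_eq_iff algebra_simps)
lemma cscale_cscale: "cscale a (cscale b A) = cscale (a * b) A"
  by (simp add: vec_eq_iff algebra_simps)
lemma cscale_zero [simp]: "cscale a 0 = 0" by (simp add: vec_eq_iff)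
lemma cscale_zero_left [simp]: "cscale 0 A = 0" by (simp add: vec_eq_iff)
lemma cscale_one [simp]: "cscale 1 A = A" by (simp add: vec_eq_iff)

lemma transpose_add: "transpose (A + B) = transpose A + transpose B"
  by (simp add: vec_eq_iff transpose_def)
lemma transpose_diff: "transpose (A - B) = transpose A - transpose (B :: 'a::ab_group_add^'n^'n)"
  by (simp add: vec_eq_iff transpose_def)
lemma transpose_cscale: "transpose (cscale a A) = cscale a (transpose A)"
  by (simp add: vec_eq_iff transpose_def)

text \<open>Expands expressions into sums of scaled words in noncommuting matrices;
  \<open>vec_eq_iff\<close> with \<open>algebra_simps\<close> can then collect equal words
  entrywise.\<close>

lemmas matrix_ring_simps = matrix_add_ldistrib matrix_add_rdistrib matrix_minus_ldistrib
  matrix_minus_rdistrib matrix_uminus_left matrix_uminus_right cscale_mult_left cscale_mult_right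
  cscale_add cscale_diff cscale_uminus cscale_cscale

lemma invertible_matrix_inv:
  assumes "invertible (A :: complex^'n^'n)"
  shows "A ** matrix_inv A = mat 1" "matrix_inv A ** A = mat 1"
  using someI_ex[OF assms[unfolded invertible_def]] unfolding matrix_inv_def by auto

lemma matrix_inv_eqI:
  fixes A B :: "complex^'n^'n"
  assumes "A ** B = mat 1" "B ** A = mat 1"
  shows "matrix_inv A = B" "invertible A"
proof -
  show i: "invertible A" using assms by (auto simp: invertible_def)
  have "matrix_inv A = matrix_inv A ** (A ** B)" by (simp add: assms)
  also have "\<dots> = B" by (simp add: matrix_mul_assoc invertible_matrix_inv[OF i])
  finally show "matrix_inv A = B" .
qed

text \<open>The determinant is a polynomial in \<epsilon> with value \<open>det A\<close> at 0, so
  it is not the zero polynomial.\<close>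

lemma invertible_eigenvalue_finite:
  fixes A B :: "complex^'n^'n"
  assumes "invertible A"
  shows "finite {\<epsilon>. \<not> invertible (\<chi> i j. A $ i $ j + \<epsilon> * B $ i $ j)}"
proof -
  define p where "p = det ((\<chi> i j. [:A $ i $ j, B $ i $ j:]) :: complex poly^'n^'n)"
  have p: "poly p \<epsilon> = det (\<chi> i j. A $ i $ j + \<epsilon> * B $ i $ j)" for \<epsilon>
    by (simp add: p_def det_def poly_sum poly_prod sign_def)
  have "p \<noteq> 0"
    using p[of 0] assms by (auto simp: invertible_det_nz)
  then show ?thesis
    using poly_roots_finite by (simp add: invertible_det_nz p[symmetric])
qed

text \<open>A relation that asserts differentiability of every entry along the line, whereas
  \<open>pd\<close>, being defined by \<open>deriv\<close>, has a value in any case.\<close>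

definition has_matrix_pd :: "(complex^'n \<Rightarrow> complex^'n^'n) \<Rightarrow> complex^'n^'n \<Rightarrow> 'n \<Rightarrow> complex^'n \<Rightarrow> bool"
  where "has_matrix_pd M M' i t \<longleftrightarrow>
    (\<forall>a b. ((\<lambda>z. M (t + z *s axis i 1) $ a $ b) has_field_derivative M' $ a $ b) (at 0))"

lemma has_matrix_pd_imp_pd: "has_matrix_pd M M' i t \<Longrightarrow> pd i (\<lambda>s. M s $ a $ b) t = M' $ a $ b"
  unfolding has_matrix_pd_def pd_def by (simp add: DERIV_imp_deriv)

lemma has_matrix_pd_eq_rhs: "has_matrix_pd M M' i t \<Longrightarrow> M' = M'' \<Longrightarrow> has_matrix_pd M M'' i t"
  by simp

lemma has_matrix_pd_const: "has_matrix_pd (\<lambda>s. A) 0 i t"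
  unfolding has_matrix_pd_def by simp

lemma has_matrix_pd_add:
  "has_matrix_pd M M' i t \<Longrightarrow> has_matrix_pd N N' i t \<Longrightarrow> has_matrix_pd (\<lambda>s. M s + N s) (M' + N') i t"
  unfolding has_matrix_pd_def by (auto intro!: DERIV_add)

lemma has_matrix_pd_diff:
  "has_matrix_pd M M' i t \<Longrightarrow> has_matrix_pd N N' i t \<Longrightarrow> has_matrix_pd (\<lambda>s. M s - N s) (M' - N') i t"
  unfolding has_matrix_pd_def by (auto intro!: DERIV_diff)

lemma has_matrix_pd_uminus:
  "has_matrix_pd M M' i t \<Longrightarrow> has_matrix_pd (\<lambda>s. - M s) (- M') i t"
  unfolding has_matrix_pd_def by (auto intro!: DERIV_minus)

lemma has_matrix_pd_cscale:
  "has_matrix_pd M M' i t \<Longrightarrow> has_matrix_pd (\<lambda>s. cscale c (M s)) (cscale c M') i t"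
  unfolding has_matrix_pd_def by (auto intro!: DERIV_cmult)

lemma has_matrix_pd_mult:
  assumes "has_matrix_pd M M' i t" "has_matrix_pd N N' i t"
  shows "has_matrix_pd (\<lambda>s. M s ** N s) (M' ** N t + M t ** N') i t"
  unfolding has_matrix_pd_def
proof (intro allI)
  fix a b
  have "((\<lambda>z. M (t + z *s axis i 1) $ a $ k * N (t + z *s axis i 1) $ k $ b) has_field_derivative
      M' $ a $ k * N t $ k $ b + N' $ k $ b * M t $ a $ k) (at 0)" for k
    using DERIV_mult[OF assms(1)[unfolded has_matrix_pd_def, rule_format, of a k]
        assms(2)[unfolded has_matrix_pd_def, rule_format, of k b]]
    by simp
  from DERIV_sum[of UNIV, OF this]
  show "((\<lambda>z. (M (t + z *s axis i 1) ** N (t + z *s axis i 1)) $ a $ b) has_field_derivative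
      (M' ** N t + M t ** N') $ a $ b) (at 0)"
    by (simp add: matrix_matrix_mult_def sum.distrib mult.commute)
qed

lemma eventually_line_in_open:
  assumes "open S" "(t :: complex^'n) \<in> S"
  shows "\<forall>\<^sub>F z in nhds 0. t + z *s axis i 1 \<in> S"
proof -
  have "((\<lambda>z. t + z *s axis i 1) \<longlongrightarrow> t + 0 *s axis i 1) (nhds (0::complex))"
    unfolding vector_scalar_mult_def by (intro tendsto_intros filterlim_ident)
  then show ?thesis
    using assms topological_tendstoD[of _ _ _ S] by simp
qed

lemma has_matrix_pd_cong:
  assumes "open S" "t \<in> S" "\<And>s. s \<in> S \<Longrightarrow> M s = N s"
  shows "has_matrix_pd M M' i t \<longleftrightarrow> has_matrix_pd N M' i t"
proof -
  have "\<forall>\<^sub>F z in nhds 0. M (t + z *s axis i 1) $ a $ b = N (t + z *s axis i 1) $ a $ b" for a b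
    using eventually_line_in_open[OF assms(1,2), of i] by (rule eventually_mono) (simp add: assms(3))
  then show ?thesis
    unfolding has_matrix_pd_def by (intro all_cong1 DERIV_cong_ev) auto
qed

lemma has_matrix_pd_unique: "has_matrix_pd M M' i t \<Longrightarrow> has_matrix_pd M M'' i t \<Longrightarrow> M' = M''"
  unfolding has_matrix_pd_def by (simp add: vec_eq_iff) (blast intro: DERIV_unique)

section \<open>Derivative of the inverse matrix\<close>

lemma det_field_differentiable:
  fixes M :: "complex \<Rightarrow> complex^'n^'n"
  assumes "\<And>a b. (\<lambda>z. M z $ a $ b) field_differentiable at w"
  shows "(\<lambda>z. det (M z)) field_differentiable at w"
proof -
  have "(\<lambda>z. \<Prod>a\<in>I. M z $ a $ p a) field_differentiable at w" for I p
    by (induction I rule: infinite_finite_induct)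
       (auto intro!: field_differentiable_mult assms)
  then show ?thesis
    unfolding det_def by (intro field_differentiable_sum field_differentiable_mult) auto
qed

lemma matrix_inv_cramer:
  fixes A :: "complex^'n^'n"
  assumes "invertible A"
  shows "matrix_inv A $ k $ l = det (\<chi> i j. if j = k then axis l 1 $ i else A $ i $ j) / det A"
proof -
  have "A *v column l (matrix_inv A) = axis l 1"
    using invertible_matrix_inv(1)[OF assms]
    by (simp add: vec_eq_iff matrix_vector_mult_def matrix_matrix_mult_def column_def mat_def axis_def)
  then have "column l (matrix_inv A) =
      (\<chi> k. det (\<chi> i j. if j = k then axis l 1 $ i else A $ i $ j) / det A)"
    using cramer[of A] assms by (simp add: invertible_det_nz)
  then show ?thesis by (simp add: vec_eq_iff column_def)
qed

text \<open>Cramer's rule shows that the inverse is differentiable; the formula then follows by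
  differentiating \<open>matrix_inv (M s) ** M s = mat 1\<close>.\<close>

lemma has_matrix_pd_inverse:
  assumes "open S" "t \<in> S" and inv: "\<And>s. s \<in> S \<Longrightarrow> invertible (M s)"
    and M: "has_matrix_pd M M' i t"
  shows "has_matrix_pd (\<lambda>s. matrix_inv (M s)) (- (matrix_inv (M t) ** M' ** matrix_inv (M t))) i t"
proof -
  let ?B = "\<lambda>s. matrix_inv (M s)"
  have d: "(\<lambda>z. M (t + z *s axis i 1) $ a $ b) field_differentiable at 0" for a b
    using M unfolding has_matrix_pd_def field_differentiable_def by blast
  have d': "(\<lambda>z. if P then c else M (t + z *s axis i 1) $ a $ b) field_differentiable at 0" for P c a b
    using d by (cases P) auto
  have "\<exists>d. ((\<lambda>z. ?B (t + z *s axis i 1) $ a $ b) has_field_derivative d) (at 0)" for a b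
  proof -
    have "(\<lambda>z. det (\<chi> k j. if j = a then axis b 1 $ k else M (t + z *s axis i 1) $ k $ j)
        / det (M (t + z *s axis i 1))) field_differentiable at 0"
      by (rule field_differentiable_divide; (rule det_field_differentiable)?)
         (use d d' inv[OF assms(2)] in \<open>auto simp: invertible_det_nz\<close>)
    then obtain d where "((\<lambda>z. det (\<chi> k j. if j = a then axis b 1 $ k else M (t + z *s axis i 1) $ k $ j)
        / det (M (t + z *s axis i 1))) has_field_derivative d) (at 0)"
      unfolding field_differentiable_def by blast
    moreover have ev: "\<forall>\<^sub>F z in nhds 0. det (\<chi> k j. if j = a then axis b 1 $ k else M (t + z *s axis i 1) $ k $ j)
        / det (M (t + z *s axis i 1)) = ?B (t + z *s axis i 1) $ a $ b"
      using eventually_line_in_open[OF assms(1,2), of i]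
      by (rule eventually_mono) (simp add: matrix_inv_cramer inv)
    ultimately show ?thesis using DERIV_cong_ev[OF refl ev refl] by blast
  qed
  then obtain d where "\<And>a b. ((\<lambda>z. ?B (t + z *s axis i 1) $ a $ b) has_field_derivative d a b) (at 0)"
    by metis
  then have B: "has_matrix_pd ?B (\<chi> a b. d a b) i t" (is "has_matrix_pd _ ?B' _ _")
    unfolding has_matrix_pd_def by simp
  have "has_matrix_pd (\<lambda>s. ?B s ** M s) 0 i t"
    using has_matrix_pd_cong[OF assms(1,2), of "\<lambda>s. ?B s ** M s" "\<lambda>s. mat 1"] has_matrix_pd_const
    by (simp add: invertible_matrix_inv inv)
  then have "?B' ** M t + ?B t ** M' = 0"
    using has_matrix_pd_unique has_matrix_pd_mult[OF B M] by blast
  then have "?B' ** M t = - (?B t ** M')"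
    by (simp add: eq_neg_iff_add_eq_0)
  then have "?B' ** M t ** ?B t = - (?B t ** M' ** ?B t)"
    by (simp add: matrix_uminus_left)
  then have "?B' = - (?B t ** M' ** ?B t)"
    by (simp add: matrix_mul_assoc[symmetric] invertible_matrix_inv inv assms(2))
  with B show ?thesis by simp
qed

subsection \<open>Metrics polynomial in the Euler multiplication\<close>

lemma transpose_matrix_inv:
  fixes A :: "complex^'n^'n"
  assumes "invertible A" "transpose A = A"
  shows "transpose (matrix_inv A) = matrix_inv A"
proof -
  have "transpose (matrix_inv A) ** A = mat 1" "A ** transpose (matrix_inv A) = mat 1"
    using arg_cong[OF invertible_matrix_inv(1)[OF assms(1)], of transpose]
      arg_cong[OF invertible_matrix_inv(2)[OF assms(1)], of transpose] assms(2)
    by (simp_all add: matrix_transpose_mul)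
  then show ?thesis using matrix_inv_eqI by metis
qed

lemma matrix_uminus_mult_uminus: "(- A) ** (- B) = A ** (B :: 'a::ring_1^'n^'n)"
  by (simp add: matrix_uminus_left matrix_uminus_right)

lemma commute_matrix_inv:
  fixes A :: "complex^'n^'n"
  assumes "invertible A" "A ** X = Y ** A"
  shows "X ** matrix_inv A = matrix_inv A ** Y"
proof -
  have "matrix_inv A ** (A ** X) ** matrix_inv A = matrix_inv A ** (Y ** A) ** matrix_inv A"
    by (simp only: assms(2))
  moreover have "matrix_inv A ** (A ** X) ** matrix_inv A = X ** matrix_inv A"
    by (simp add: matrix_mul_assoc invertible_matrix_inv[OF assms(1)])
  moreover have "matrix_inv A ** (Y ** A) ** matrix_inv A = matrix_inv A ** Y"
    by (simp add: matrix_mul_assoc[symmetric] invertible_matrix_inv[OF assms(1)])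
  ultimately show ?thesis by simp
qed

text \<open>The algebra behind flatness, with \<open>L\<close> in the role of the inverse of the
  metric factor. The terms with \<open>K\<close>, \<open>W\<close> and \<open>R\<close> are
  symmetric in \<open>A\<close> and \<open>B\<close> and cancel; the terms
  \<open>Q L A Q L B\<close> from the derivative of the inverse cancel the quadratic ones; what is
  left is \<open>Q L Q\<close> times \<open>A L B - B L A\<close>, which is zero.\<close>

lemma commutator_cancellation:
  fixes A B L Q W K R :: "complex^'n^'n"
  assumes [simp]: "A ** B = B ** A" "A ** L = L ** A" "B ** L = L ** B"
    and [simp]: "A ** W = W ** A" "B ** W = W ** B" "L ** W = W ** L"
  defines "dA \<equiv> A ** (W - Q) + Q ** A" and "dB \<equiv> B ** (W - Q) + Q ** B"
  shows "- ((K ** A ** L + Q ** - (L ** dA ** L)) ** B + Q ** L ** R)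
    - - ((K ** B ** L + Q ** - (L ** dB ** L)) ** A + Q ** L ** R)
    + Q ** L ** A ** (Q ** L ** B) - Q ** L ** B ** (Q ** L ** A) = 0"
proof -
  \<comment> \<open>The hypotheses act at the start of a left-associated product; these variants act
    after a prefix \<open>X\<close>, so commuting factors get sorted anywhere in a word.\<close>
  have [simp]: "X ** A ** B = X ** B ** A" "X ** A ** L = X ** L ** A" "X ** B ** L = X ** L ** B"
    "X ** A ** W = X ** W ** A" "X ** B ** W = X ** W ** B" "X ** L ** W = X ** W ** L" for X
    using assms(1-6) by (simp_all only: matrix_mul_assoc[symmetric])
  show ?thesis
    unfolding dA_def dB_def by (simp add: matrix_ring_simps matrix_mul_assoc)
qed

text \<open>The matrix identities on which flatness rests, free of the potential.
  \<open>C_lower\<close> is commutativity of the product, \<open>C_adj\<close> and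
  \<open>U_adj\<close> its compatibility with \<eta>, \<open>dC_sym\<close> the symmetry of fourth
  derivatives, \<open>dU\<close> homogeneity.\<close>

locale frobenius_pencil =
  fixes D :: "(complex^'n) set" and H P :: "complex^'n^'n" and U :: "complex^'n \<Rightarrow> complex^'n^'n"
    and C :: "'n \<Rightarrow> complex^'n \<Rightarrow> complex^'n^'n" and dC :: "'n \<Rightarrow> 'n \<Rightarrow> complex^'n \<Rightarrow> complex^'n^'n"
    and m :: complex
  assumes open_D: "open D" and inv_H: "invertible H" and sym_H: "transpose H = H"
    and U_hol: "\<And>\<alpha> \<beta>. holomorphic_vec_on (\<lambda>t. U t $ \<alpha> $ \<beta>) D"
    and C_lower: "\<And>\<alpha> \<beta> \<gamma> t. t \<in> D \<Longrightarrow> C \<gamma> t $ \<alpha> $ \<beta> = C \<beta> t $ \<alpha> $ \<gamma>"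
    and C_comm: "\<And>\<gamma> \<delta> t. t \<in> D \<Longrightarrow> C \<gamma> t ** C \<delta> t = C \<delta> t ** C \<gamma> t"
    and CU_comm: "\<And>\<gamma> t. t \<in> D \<Longrightarrow> C \<gamma> t ** U t = U t ** C \<gamma> t"
    and C_adj: "\<And>\<gamma> t. t \<in> D \<Longrightarrow> H ** transpose (C \<gamma> t) = C \<gamma> t ** H"
    and U_adj: "\<And>t. t \<in> D \<Longrightarrow> H ** transpose (U t) = U t ** H"
    and P_adj: "H ** transpose P = - (P ** H)"
    and P_sq: "P ** P = cscale m (mat 1)"
    and dC: "\<And>\<gamma> \<delta> t. t \<in> D \<Longrightarrow> has_matrix_pd (C \<gamma>) (dC \<gamma> \<delta> t) \<delta> t"
    and dC_sym: "\<And>\<gamma> \<delta> t. t \<in> D \<Longrightarrow> dC \<gamma> \<delta> t = dC \<delta> \<gamma> t"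
    and dU: "\<And>\<gamma> t. t \<in> D \<Longrightarrow> has_matrix_pd U (C \<gamma> t - P ** C \<gamma> t + C \<gamma> t ** P) \<gamma> t"
begin

definition L where "L a b c t = cscale a (U t ** U t) + cscale b (U t) + cscale c (mat 1)"
text \<open>The formal derivative of \<open>L\<close> as a polynomial in \<open>U\<close>, and also
  the sum of \<open>Y\<close> and \<open>Q\<close>; on \<open>D\<close> it commutes with
  \<open>C\<close> and \<open>L\<close>.\<close>

definition W where "W a b t = cscale (2 * a) (U t) + cscale b (mat 1)"
definition Y where "Y a b t = cscale a (U t + U t ** P + P ** U t) + cscale b (cscale (1/2) (mat 1) + P)"
definition Q where "Q a b t = cscale a (U t - U t ** P - P ** U t) + cscale b (cscale (1/2) (mat 1) - P)"
text \<open>Selfadjointness of \<open>U\<close>, hence \<open>h = L H\<close>, is available only on \<open>D\<close>; with the transpose the metrics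
  of the theorem are instances of \<open>h\<close> as functions on the whole space.\<close>

definition h where "h a b c t = H ** transpose (L a b c t)"

lemma Y_eq: "Y a b t = W a b t - Q a b t"
  by (simp add: Y_def W_def Q_def matrix_ring_simps) (simp add: vec_eq_iff algebra_simps)

context
  fixes t assumes t: "t \<in> D"
begin

lemma CU_comm': "X ** C \<gamma> t ** U t = X ** U t ** C \<gamma> t"
  using CU_comm[OF t] by (simp add: matrix_mul_assoc[symmetric])

lemma C_L: "C \<gamma> t ** L a b c t = L a b c t ** C \<gamma> t"
  by (simp add: L_def matrix_ring_simps matrix_mul_assoc CU_comm[OF t] CU_comm')

lemma C_W: "C \<gamma> t ** W a b t = W a b t ** C \<gamma> t"
  by (simp add: W_def matrix_ring_simps CU_comm[OF t])

lemma L_W: "L a b c t ** W a' b' t = W a' b' t ** L a b c t"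
  by (simp add: W_def L_def matrix_ring_simps matrix_mul_assoc mult.commute)

lemma L_adj: "H ** transpose (L a b c t) = L a b c t ** H"
  using U_adj[OF t]
  by (simp add: L_def transpose_add transpose_cscale matrix_transpose_mul matrix_ring_simps matrix_mul_assoc)
     (simp add: matrix_mul_assoc[symmetric])

text \<open>Adjunction reverses products and changes the sign of \<open>P\<close>; as
  \<open>U P\<close> and \<open>P U\<close> enter symmetrically, \<open>Y\<close> becomes
  \<open>Q\<close>.\<close>

lemma Y_adj: "H ** transpose (Y a b t) = Q a b t ** H"
  using U_adj[OF t] P_adj
  apply (simp add: Y_def Q_def transpose_add transpose_diff transpose_cscale matrix_transpose_mul matrix_ring_simps matrix_mul_assoc)
  apply (simp add: matrix_mul_assoc[symmetric] matrix_ring_simps)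
  done

lemma h_eq: "h a b c t = L a b c t ** H"
  unfolding h_def by (rule L_adj)

lemma transpose_h: "transpose (h a b c t) = h a b c t"
  by (simp add: h_def L_adj[symmetric] matrix_transpose_mul sym_H)

text \<open>Since \<open>C\<close> commutes with \<open>U\<close>, the derivative splits into a term
  with \<open>C\<close> on the left and one with \<open>C\<close> on the right. Multiplied by
  \<open>H\<close> they are transposes of each other: the two Christoffel terms in the derivative of
  the metric.\<close>

lemma dL: "has_matrix_pd (L a b c) (C \<gamma> t ** Y a b t + Q a b t ** C \<gamma> t) \<gamma> t"
  unfolding L_def
  apply (rule has_matrix_pd_eq_rhs)
   apply (rule has_matrix_pd_add has_matrix_pd_cscale has_matrix_pd_mult dU t has_matrix_pd_const)+
  apply (simp add: Y_def Q_def matrix_ring_simps matrix_mul_assoc CU_comm[OF t] CU_comm')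
  apply (simp add: vec_eq_iff algebra_simps)
  done

text \<open>The terms \<open>P C P\<close> cancel, and the rest beyond the claim is the commutator
  of \<open>P ** P\<close> with \<open>C\<close>, zero because \<open>P ** P\<close> is scalar. The
  constant factor left of \<open>C\<close> is the \<open>K\<close> of
  \<open>commutator_cancellation\<close>.\<close>

lemma dQ: "has_matrix_pd (Q a b) (cscale a (mat 1 - cscale 2 P) ** C \<gamma> t) \<gamma> t"
proof -
  have PP: "C \<gamma> t ** P ** P = P ** P ** C \<gamma> t"
    by (simp add: P_sq matrix_ring_simps matrix_mul_assoc[symmetric])
  show ?thesis
    unfolding Q_def
    apply (rule has_matrix_pd_eq_rhs)
     apply (rule has_matrix_pd_add has_matrix_pd_diff has_matrix_pd_cscale has_matrix_pd_mult dU t has_matrix_pd_const)+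
    apply (simp add: matrix_ring_simps matrix_mul_assoc PP)
    apply (simp add: vec_eq_iff algebra_simps)
    done
qed

lemma invertible_h: "invertible (L a b c t) \<Longrightarrow> invertible (h a b c t)"
  and matrix_inv_h: "invertible (L a b c t) \<Longrightarrow> matrix_inv (h a b c t) = matrix_inv H ** matrix_inv (L a b c t)"
proof -
  assume L: "invertible (L a b c t)"
  have 1: "h a b c t ** (matrix_inv H ** matrix_inv (L a b c t)) = mat 1"
  proof -
    have "h a b c t ** (matrix_inv H ** matrix_inv (L a b c t)) = L a b c t ** (H ** matrix_inv H) ** matrix_inv (L a b c t)"
      by (simp add: h_eq matrix_mul_assoc)
    then show ?thesis by (simp add: invertible_matrix_inv inv_H L)
  qed
  then have 2: "matrix_inv H ** matrix_inv (L a b c t) ** h a b c t = mat 1"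
    by (simp add: matrix_left_right_inverse)
  show "invertible (h a b c t)" "matrix_inv (h a b c t) = matrix_inv H ** matrix_inv (L a b c t)"
    using matrix_inv_eqI[OF 1 2] by auto
qed

lemma invertible_h_iff: "invertible (h a b c t) \<longleftrightarrow> invertible (L a b c t)"
  using inv_H by (auto simp: invertible_det_nz h_eq det_mul)

lemma christoffel_transpose: "transpose (C \<gamma> t ** Y a b t ** H) = Q a b t ** C \<gamma> t ** H"
proof -
  have "transpose (C \<gamma> t ** Y a b t ** H) = (H ** transpose (Y a b t)) ** transpose (C \<gamma> t)"
    by (simp add: matrix_transpose_mul sym_H matrix_mul_assoc)
  also have "\<dots> = Q a b t ** (H ** transpose (C \<gamma> t))"
    by (simp add: Y_adj matrix_mul_assoc)
  finally show ?thesis by (simp add: C_adj[OF t] matrix_mul_assoc)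
qed

text \<open>The torsion-free condition in matrix form; it follows from selfadjointness of
  \<open>C\<close> and \<open>C_L\<close>.\<close>

lemma C_h_sym: "transpose (C \<gamma> t ** h a b c t) = C \<gamma> t ** h a b c t"
proof -
  have "transpose (C \<gamma> t ** h a b c t) = L a b c t ** (H ** transpose (C \<gamma> t))"
    by (simp add: matrix_transpose_mul transpose_h) (simp add: h_eq matrix_mul_assoc)
  then show ?thesis
    by (simp add: C_adj[OF t] h_eq matrix_mul_assoc C_L)
qed

end

section \<open>Christoffel symbols of the family \<open>h\<close>\<close>

lemma dh: "t \<in> D \<Longrightarrow> has_matrix_pd (h a b c) ((C \<gamma> t ** Y a b t + Q a b t ** C \<gamma> t) ** H) \<gamma> t"
  using has_matrix_pd_mult[OF dL[of t a b c \<gamma>] has_matrix_pd_const[of H]]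
    has_matrix_pd_cong[OF open_D, of t "h a b c" "\<lambda>t. L a b c t ** H"]
  by (simp add: h_eq)

lemma is_christoffel:
  assumes t: "t \<in> D"
  shows "is_contravariant_christoffel (h a b c) t (\<lambda>\<alpha> \<beta> \<gamma>. (C \<gamma> t ** Y a b t ** H) $ \<alpha> $ \<beta>)"
  unfolding is_contravariant_christoffel_def
proof (intro conjI allI)
  fix \<alpha> \<beta> \<gamma>
  have "(C \<gamma> t ** Y a b t ** H) $ \<beta> $ \<alpha> = (Q a b t ** C \<gamma> t ** H) $ \<alpha> $ \<beta>"
    using christoffel_transpose[OF t, of \<gamma> a b] by (simp add: vec_eq_iff transpose_def)
  then show "pd \<gamma> (\<lambda>s. h a b c s $ \<alpha> $ \<beta>) t =
      (C \<gamma> t ** Y a b t ** H) $ \<alpha> $ \<beta> + (C \<gamma> t ** Y a b t ** H) $ \<beta> $ \<alpha>"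
    using has_matrix_pd_imp_pd[OF dh[OF t, of a b c \<gamma>], of \<alpha> \<beta>] by (simp add: matrix_add_rdistrib)
next
  fix \<alpha> \<beta> \<gamma>
  \<comment> \<open>\<open>C_lower\<close> exchanges the label of \<open>C\<close> with its column,
    so that the sum over \<nu> becomes the product \<open>C \<kappa> t ** h a b c t\<close>,
    symmetric by \<open>C_h_sym\<close>.\<close>
  have *: "(\<Sum>\<nu>\<in>UNIV. h a b c t $ \<alpha> $ \<nu> * (C \<nu> t ** Y a b t ** H) $ \<beta> $ \<gamma>) =
      (\<Sum>\<kappa>\<in>UNIV. (C \<kappa> t ** h a b c t) $ \<beta> $ \<alpha> * (Y a b t ** H) $ \<kappa> $ \<gamma>)" for \<alpha> \<beta>
  proof -
    have "(\<Sum>\<nu>\<in>UNIV. h a b c t $ \<alpha> $ \<nu> * (C \<nu> t ** Y a b t ** H) $ \<beta> $ \<gamma>) =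
      (\<Sum>\<nu>\<in>UNIV. \<Sum>\<kappa>\<in>UNIV. h a b c t $ \<alpha> $ \<nu> * (C \<nu> t $ \<beta> $ \<kappa> * (Y a b t ** H) $ \<kappa> $ \<gamma>))"
      unfolding matrix_mul_assoc[symmetric]
      unfolding matrix_matrix_mult_def[of "C _ t" "Y a b t ** H"] by (simp add: sum_distrib_left)
    also have "\<dots> = (\<Sum>\<nu>\<in>UNIV. \<Sum>\<kappa>\<in>UNIV. h a b c t $ \<nu> $ \<alpha> * (C \<kappa> t $ \<beta> $ \<nu> * (Y a b t ** H) $ \<kappa> $ \<gamma>))"
      using transpose_h[OF t, of a b c] C_lower[OF t]
      by (intro sum.cong refl) (simp add: vec_eq_iff transpose_def)
    also have "\<dots> = (\<Sum>\<kappa>\<in>UNIV. (C \<kappa> t ** h a b c t) $ \<beta> $ \<alpha> * (Y a b t ** H) $ \<kappa> $ \<gamma>)"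
      by (subst sum.swap) (simp add: matrix_matrix_mult_def[of "C _ t"] sum_distrib_left mult_ac)
    finally show ?thesis .
  qed
  have "(C \<kappa> t ** h a b c t) $ \<beta> $ \<alpha> = (C \<kappa> t ** h a b c t) $ \<alpha> $ \<beta>" for \<kappa>
    using C_h_sym[OF t, of \<kappa> a b c] by (simp add: vec_eq_iff transpose_def)
  then show "(\<Sum>\<nu>\<in>UNIV. h a b c t $ \<alpha> $ \<nu> * (C \<nu> t ** Y a b t ** H) $ \<beta> $ \<gamma>) =
     (\<Sum>\<nu>\<in>UNIV. h a b c t $ \<beta> $ \<nu> * (C \<nu> t ** Y a b t ** H) $ \<alpha> $ \<gamma>)"
    unfolding * by simp
qed

lemma L_hol: "holomorphic_vec_on (\<lambda>t. L a b c t $ \<alpha> $ \<beta>) D"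
  by (simp add: L_def matrix_matrix_mult_def) (intro holomorphic_vec_intros U_hol)

lemma h_hol: "holomorphic_vec_on (\<lambda>t. h a b c t $ \<alpha> $ \<beta>) D"
  by (simp add: h_def matrix_matrix_mult_def transpose_def) (intro holomorphic_vec_intros L_hol)

text \<open>The determinant is a polynomial in holomorphic entries, hence continuous.\<close>

lemma open_invertible: "open {t \<in> D. invertible (L a b c t)}"
proof -
  have "holomorphic_vec_on (\<lambda>t. det (L a b c t)) D"
  proof -
    have "holomorphic_vec_on (\<lambda>t. \<Prod>i\<in>I. L a b c t $ i $ p i) D" for I p
      by (induction I rule: infinite_finite_induct)
         (auto intro!: holomorphic_vec_intros L_hol)
    then show ?thesis unfolding det_def by (intro holomorphic_vec_intros)
  qed
  then have "open (D \<inter> (\<lambda>t. det (L a b c t)) -` (- {0}))"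
    using holomorphic_vec_continuous_on open_D by (intro continuous_open_preimage) auto
  also have "D \<inter> (\<lambda>t. det (L a b c t)) -` (- {0}) = {t \<in> D. invertible (L a b c t)}"
    by (auto simp: invertible_det_nz)
  finally show ?thesis .
qed

section \<open>Connection matrices and curvature\<close>

context
  fixes S a b c
  assumes S: "open S" "S \<subseteq> D" and inv_L: "\<And>t. t \<in> S \<Longrightarrow> invertible (L a b c t)"
begin

lemma contravariant_metric_h: "contravariant_metric_on S (h a b c)"
  unfolding contravariant_metric_on_def
  using S inv_L holomorphic_vec_on_subset[OF h_hol S(2)] by (auto simp: transpose_h invertible_h subset_iff)

lemma contravariant_christoffel_h:
  "t \<in> S \<Longrightarrow> contravariant_christoffel (h a b c) t = (\<lambda>\<alpha> \<beta> \<gamma>. (C \<gamma> t ** Y a b t ** H) $ \<alpha> $ \<beta>)"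
  unfolding contravariant_christoffel_def
  using ex1_contravariant_christoffel[OF S(1) _ contravariant_metric_h] is_christoffel S(2)
  by (intro the1_equality) auto

text \<open>Arranged so that the direction \<mu> labels a matrix with row \<beta> and column
  \<gamma>; the quadratic terms of the curvature then are matrix products.\<close>

lemma christoffel_h:
  assumes "t \<in> S"
  shows "christoffel (h a b c) t \<beta> \<mu> \<gamma> = (- (Q a b t ** matrix_inv (L a b c t) ** C \<mu> t)) $ \<beta> $ \<gamma>"
proof -
  have t: "t \<in> D" and L: "invertible (L a b c t)" using assms S inv_L by auto
  have "christoffel (h a b c) t \<beta> \<mu> \<gamma> = - (matrix_inv (h a b c t) ** (C \<gamma> t ** Y a b t ** H)) $ \<mu> $ \<beta>"
    unfolding christoffel_def contravariant_christoffel_h[OF assms]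
    by (simp add: matrix_matrix_mult_def[of "matrix_inv _"])
  also have "\<dots> = - transpose (matrix_inv (h a b c t) ** (C \<gamma> t ** Y a b t ** H)) $ \<beta> $ \<mu>"
    by (simp add: transpose_def)
  also have "transpose (matrix_inv (h a b c t) ** (C \<gamma> t ** Y a b t ** H)) =
      transpose (C \<gamma> t ** Y a b t ** H) ** matrix_inv (h a b c t)"
    by (simp only: matrix_transpose_mul[of "matrix_inv _"] transpose_matrix_inv invertible_h transpose_h t L)
  also have "\<dots> = Q a b t ** C \<gamma> t ** (H ** matrix_inv H) ** matrix_inv (L a b c t)"
    by (simp add: christoffel_transpose[OF t] matrix_inv_h[OF t L] matrix_mul_assoc)
  also have "\<dots> = Q a b t ** (C \<gamma> t ** matrix_inv (L a b c t))"
    by (simp add: invertible_matrix_inv inv_H matrix_mul_assoc)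
  also have "C \<gamma> t ** matrix_inv (L a b c t) = matrix_inv (L a b c t) ** C \<gamma> t"
    by (rule commute_matrix_inv[OF L C_L[OF t, symmetric]])
  also have "(Q a b t ** (matrix_inv (L a b c t) ** C \<gamma> t)) $ \<beta> $ \<mu> =
      (Q a b t ** matrix_inv (L a b c t) ** C \<mu> t) $ \<beta> $ \<gamma>"
    using C_lower[OF t, of \<gamma> _ \<mu>]
    by (simp add: matrix_mul_assoc matrix_matrix_mult_def[of "Q a b t ** matrix_inv (L a b c t)"])
  finally show ?thesis by simp
qed

text \<open>In matrix form the curvature is the antisymmetrised derivative of the connection
  matrices plus their commutator, and its vanishing reduces to
  \<open>commutator_cancellation\<close>.\<close>

lemma flat_h: "flat_metric_on S (h a b c)"
  unfolding flat_metric_on_def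
proof (intro conjI contravariant_metric_h ballI allI)
  fix t \<delta> \<gamma> \<alpha> \<beta> assume tS: "t \<in> S"
  then have t: "t \<in> D" and L: "invertible (L a b c t)" using S inv_L by auto
  define B where "B s = matrix_inv (L a b c s)" for s
  define A where "A \<mu> s = - (Q a b s ** B s ** C \<mu> s)" for \<mu> s
  \<comment> \<open>The product rule applied to \<open>A\<close>, with \<open>Y\<close> already
    written as \<open>W - Q\<close> to match \<open>commutator_cancellation\<close>.\<close>
  define dA where "dA \<mu> \<nu> =
    - ((cscale a (mat 1 - cscale 2 P) ** C \<nu> t ** B t +
      Q a b t ** - (B t ** (C \<nu> t ** (W a b t - Q a b t) + Q a b t ** C \<nu> t) ** B t)) ** C \<mu> t
     + Q a b t ** B t ** dC \<mu> \<nu> t)" for \<mu> \<nu>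
  have dB: "has_matrix_pd B (- (B t ** (C \<nu> t ** Y a b t + Q a b t ** C \<nu> t) ** B t)) \<nu> t" for \<nu>
    unfolding B_def by (rule has_matrix_pd_inverse[OF S(1) tS inv_L dL[OF t]])
  have "has_matrix_pd (A \<mu>) (dA \<mu> \<nu>) \<nu> t" for \<mu> \<nu>
    unfolding A_def dA_def Y_eq[symmetric]
    by (intro has_matrix_pd_uminus has_matrix_pd_mult dQ dB dC t)
  then have pdA: "pd \<nu> (\<lambda>s. christoffel (h a b c) s \<delta> \<mu> \<gamma>) t = dA \<mu> \<nu> $ \<delta> $ \<gamma>" for \<mu> \<nu>
    using has_matrix_pd_imp_pd[of "A \<mu>" "dA \<mu> \<nu>" \<nu> t \<delta> \<gamma>]
      pd_cong_open[OF S(1) tS, of "\<lambda>s. christoffel (h a b c) s \<delta> \<mu> \<gamma>" "\<lambda>s. A \<mu> s $ \<delta> $ \<gamma>" \<nu>]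
    by (simp add: christoffel_h A_def B_def)
  have "curvature (h a b c) t \<delta> \<gamma> \<alpha> \<beta> =
      (dA \<beta> \<alpha> - dA \<alpha> \<beta> + A \<alpha> t ** A \<beta> t - A \<beta> t ** A \<alpha> t) $ \<delta> $ \<gamma>"
    unfolding curvature_def pdA christoffel_h[OF tS] A_def B_def
    by (simp add: matrix_matrix_mult_def[of "- _"])
  also have "dA \<beta> \<alpha> - dA \<alpha> \<beta> + A \<alpha> t ** A \<beta> t - A \<beta> t ** A \<alpha> t = 0"
    unfolding dA_def A_def matrix_uminus_mult_uminus dC_sym[OF t, of \<beta> \<alpha>]
  proof (rule commutator_cancellation)
    show "C \<alpha> t ** B t = B t ** C \<alpha> t" "C \<beta> t ** B t = B t ** C \<beta> t"
      "B t ** W a b t = W a b t ** B t"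
      unfolding B_def using commute_matrix_inv[OF L C_L[OF t, symmetric]] commute_matrix_inv[OF L L_W[OF t]]
      by auto
  qed (use C_comm[OF t] C_W[OF t] in auto)
  finally show "curvature (h a b c) t \<delta> \<gamma> \<alpha> \<beta> = 0" by simp
qed

end

section \<open>Pencils within the family \<open>h\<close>\<close>

lemma pencil_h: "pencil (h a b c) (h a' b' c') \<epsilon> = h (a + \<epsilon> * a') (b + \<epsilon> * b') (c + \<epsilon> * c')"
proof
  fix t
  have "h (a + \<epsilon> * a') (b + \<epsilon> * b') (c + \<epsilon> * c') t = h a b c t + cscale \<epsilon> (h a' b' c' t)"
    unfolding h_def L_def transpose_add transpose_cscale matrix_ring_simps
    by (simp add: vec_eq_iff algebra_simps)
  then show "pencil (h a b c) (h a' b' c') \<epsilon> t = h (a + \<epsilon> * a') (b + \<epsilon> * b') (c + \<epsilon> * c') t"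
    by (simp add: pencil_def vec_eq_iff)
qed

lemma Y_pencil: "Y (a + \<epsilon> * a') (b + \<epsilon> * b') t = Y a b t + cscale \<epsilon> (Y a' b' t)"
  by (simp add: Y_def vec_eq_iff algebra_simps)

text \<open>A pencil of two members is again a member, so \<open>flat_h\<close> applies to it
  directly; the condition on Christoffel symbols is the linearity of \<open>Y\<close> in its
  coefficients.\<close>

theorem compatible_h:
  assumes S: "open S" "S \<subseteq> D"
    and 1: "\<And>t. t \<in> S \<Longrightarrow> invertible (L a b c t)"
    and 2: "\<And>t. t \<in> S \<Longrightarrow> invertible (L a' b' c' t)"
  shows "compatible_metrics_on S (h a b c) (h a' b' c')"
  unfolding compatible_metrics_on_def Let_def
proof (intro conjI ballI allI)
  show "contravariant_metric_on S (h a b c)" "contravariant_metric_on S (h a' b' c')"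
    using contravariant_metric_h[OF S] 1 2 by auto
  fix t assume "t \<in> S"
  then have "invertible (h a b c t)" using invertible_h 1 S by auto
  then show "finite {\<epsilon>. \<not> invertible (pencil (h a b c) (h a' b' c') \<epsilon> t)}"
    unfolding pencil_def by (rule invertible_eigenvalue_finite)
next
  fix \<epsilon>
  let ?S = "{t \<in> S. invertible (pencil (h a b c) (h a' b' c') \<epsilon> t)}"
  let ?L = "L (a + \<epsilon> * a') (b + \<epsilon> * b') (c + \<epsilon> * c')"
  have "?S = S \<inter> {t \<in> D. invertible (?L t)}"
    using S(2) by (auto simp: pencil_h invertible_h_iff)
  then have S': "open ?S" "?S \<subseteq> D" "\<And>t. t \<in> ?S \<Longrightarrow> invertible (?L t)"
    using S open_invertible open_Int by auto
  show "flat_metric_on ?S (pencil (h a b c) (h a' b' c') \<epsilon>)"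
    using flat_h[OF S'] by (simp add: pencil_h)
  fix t \<alpha> \<beta> \<gamma> assume t: "t \<in> ?S"
  then have "t \<in> S" by simp
  show "contravariant_christoffel (pencil (h a b c) (h a' b' c') \<epsilon>) t \<alpha> \<beta> \<gamma> =
      contravariant_christoffel (h a b c) t \<alpha> \<beta> \<gamma> + \<epsilon> * contravariant_christoffel (h a' b' c') t \<alpha> \<beta> \<gamma>"
    using contravariant_christoffel_h[OF S' t] contravariant_christoffel_h[OF S 1 \<open>t \<in> S\<close>]
      contravariant_christoffel_h[OF S 2 \<open>t \<in> S\<close>]
    by (simp add: pencil_h Y_pencil matrix_ring_simps)
qed

end

subsection \<open>Frobenius manifolds with two Euler weights\<close>

lemma pd_eqI: "((\<lambda>z. f (t + z *s axis i 1)) has_field_derivative f') (at 0) \<Longrightarrow> pd i f t = f'"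
  unfolding pd_def by (rule DERIV_imp_deriv)

lemma holomorphic_vec_line_derivative_0:
  "holomorphic_vec_on f D \<Longrightarrow> t \<in> D \<Longrightarrow> ((\<lambda>z. f (t + z *s axis i 1)) has_field_derivative pd i f t) (at 0)"
  using holomorphic_vec_line_derivative[of f D t 0 i] by simp

lemma pd_const: "pd i (\<lambda>t. c) t = 0"
  by (rule pd_eqI) simp

lemma pd_nth: "pd i (\<lambda>t. t $ j) t = (if i = j then 1 else 0)"
  by (rule pd_eqI) (auto simp: axis_def intro!: derivative_eq_intros)

lemma pd_add:
  assumes "holomorphic_vec_on f D" "holomorphic_vec_on g D" "t \<in> D"
  shows "pd i (\<lambda>t. f t + g t) t = pd i f t + pd i g t"
  using assms by (intro pd_eqI DERIV_add holomorphic_vec_line_derivative_0)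

lemma pd_mult:
  assumes "holomorphic_vec_on f D" "holomorphic_vec_on g D" "t \<in> D"
  shows "pd i (\<lambda>t. f t * g t) t = pd i f t * g t + f t * pd i g t"
  using DERIV_mult[OF holomorphic_vec_line_derivative_0[OF assms(1,3)]
      holomorphic_vec_line_derivative_0[OF assms(2,3)], of i]
  by (intro pd_eqI) (simp add: mult.commute)

lemma pd_sum:
  assumes "\<And>j. j \<in> I \<Longrightarrow> holomorphic_vec_on (f j) D" "t \<in> D"
  shows "pd i (\<lambda>t. \<Sum>j\<in>I. f j t) t = (\<Sum>j\<in>I. pd i (f j) t)"
  using assms by (intro pd_eqI DERIV_sum holomorphic_vec_line_derivative_0)

lemma pd_weighted_sum:
  assumes "\<And>j. holomorphic_vec_on (f j) D" "t \<in> D"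
  shows "pd i (\<lambda>t. \<Sum>j\<in>UNIV. w j * t $ j * f j t) t =
    w i * f i t + (\<Sum>j\<in>UNIV. w j * t $ j * pd i (f j) t)"
proof -
  have 1: "pd i (\<lambda>t. w j * t $ j * f j t) t = (if i = j then w j * f j t else 0) + w j * t $ j * pd i (f j) t" for j
    using pd_mult[of "\<lambda>t. w j * t $ j" D "f j" t i] pd_mult[of "\<lambda>t. w j" D "\<lambda>t. t $ j" t i] assms
    by (simp add: holomorphic_vec_intros pd_const pd_nth)
  have "pd i (\<lambda>t. \<Sum>j\<in>UNIV. w j * t $ j * f j t) t = (\<Sum>j\<in>UNIV. pd i (\<lambda>t. w j * t $ j * f j t) t)"
    using assms(2) by (intro pd_sum[where D=D] holomorphic_vec_intros assms(1))
  then show ?thesis by (simp add: 1 sum.distrib)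
qed

text \<open>Moving \<open>pd i\<close> past the Euler derivation produces
  \<open>w i * pd i G\<close>, so each differentiation lowers the degree by the weight of its
  variable.\<close>

lemma euler_homogeneity_pd:
  assumes D: "open D" and G: "holomorphic_vec_on G D" and q: "holomorphic_vec_on q D"
    and eq: "\<And>t. t \<in> D \<Longrightarrow> (\<Sum>j\<in>UNIV. w j * t $ j * pd j G t) = l * G t + q t" and t: "t \<in> D"
  shows "(\<Sum>j\<in>UNIV. w j * t $ j * pd j (pd i G) t) = (l - w i) * pd i G t + pd i q t"
proof -
  have "pd i (\<lambda>t. \<Sum>j\<in>UNIV. w j * t $ j * pd j G t) t = pd i (\<lambda>t. l * G t + q t) t"
    by (rule pd_cong_open[OF D t eq])
  also have "\<dots> = l * pd i G t + pd i q t"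
    using pd_add[of "\<lambda>t. l * G t" D q t i] pd_mult[of "\<lambda>t. l" D G t i] G q t
    by (simp add: holomorphic_vec_intros pd_const)
  finally show ?thesis
    using pd_weighted_sum[of "\<lambda>j. pd j G" D t i w] holomorphic_vec_pd[OF D G] t
    by (simp add: algebra_simps)
qed

text \<open>Removes the quadratic ambiguity in the homogeneity of the potential after three
  derivatives.\<close>

lemma third_pd_quadratic:
  fixes a :: "complex^'n^'n" and b :: "complex^'n"
  shows "pd k (pd j (pd i (\<lambda>t. (\<Sum>\<alpha>\<in>UNIV. \<Sum>\<beta>\<in>UNIV. a $ \<alpha> $ \<beta> * t $ \<alpha> * t $ \<beta>) + (\<Sum>\<alpha>\<in>UNIV. b $ \<alpha> * t $ \<alpha>) + c))) t = 0"
proof -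
  have lin: "pd i (\<lambda>t. \<Sum>\<alpha>\<in>UNIV. v \<alpha> * t $ \<alpha>) t = v i" for v :: "'n \<Rightarrow> complex" and i t
    using pd_weighted_sum[of "\<lambda>j t. 1" UNIV t i v] by (simp add: holomorphic_vec_intros pd_const)
  have hlin: "holomorphic_vec_on (\<lambda>t. \<Sum>\<alpha>\<in>UNIV. v \<alpha> * t $ \<alpha>) UNIV" for v :: "'n \<Rightarrow> complex"
    by (intro holomorphic_vec_intros)
  have quad: "pd i (\<lambda>t. \<Sum>\<alpha>\<in>UNIV. \<Sum>\<beta>\<in>UNIV. a $ \<alpha> $ \<beta> * t $ \<alpha> * t $ \<beta>) t = (\<Sum>\<beta>\<in>UNIV. (a $ i $ \<beta> + a $ \<beta> $ i) * t $ \<beta>)" for i t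
  proof -
    have "pd i (\<lambda>t. \<Sum>\<alpha>\<in>UNIV. 1 * t $ \<alpha> * (\<Sum>\<beta>\<in>UNIV. a $ \<alpha> $ \<beta> * t $ \<beta>)) t =
        1 * (\<Sum>\<beta>\<in>UNIV. a $ i $ \<beta> * t $ \<beta>) + (\<Sum>\<alpha>\<in>UNIV. 1 * t $ \<alpha> * a $ \<alpha> $ i)"
      by (subst pd_weighted_sum[of _ UNIV]) (auto simp only: lin hlin UNIV_I)
    then show ?thesis
      by (simp add: sum_distrib_left algebra_simps sum.distrib)
  qed
  have 1: "pd i (\<lambda>t. (\<Sum>\<alpha>\<in>UNIV. \<Sum>\<beta>\<in>UNIV. a $ \<alpha> $ \<beta> * t $ \<alpha> * t $ \<beta>) + (\<Sum>\<alpha>\<in>UNIV. b $ \<alpha> * t $ \<alpha>) + c) =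
      (\<lambda>t. (\<Sum>\<beta>\<in>UNIV. (a $ i $ \<beta> + a $ \<beta> $ i) * t $ \<beta>) + b $ i)"
  proof
    fix t
    have "holomorphic_vec_on (\<lambda>t. \<Sum>\<alpha>\<in>UNIV. \<Sum>\<beta>\<in>UNIV. a $ \<alpha> $ \<beta> * t $ \<alpha> * t $ \<beta>) UNIV"
      by (intro holomorphic_vec_intros)
    then show "pd i (\<lambda>t. (\<Sum>\<alpha>\<in>UNIV. \<Sum>\<beta>\<in>UNIV. a $ \<alpha> $ \<beta> * t $ \<alpha> * t $ \<beta>) + (\<Sum>\<alpha>\<in>UNIV. b $ \<alpha> * t $ \<alpha>) + c) t =
      (\<Sum>\<beta>\<in>UNIV. (a $ i $ \<beta> + a $ \<beta> $ i) * t $ \<beta>) + b $ i"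
      using hlin[of "($) b"]
      by (simp add: pd_add[of _ UNIV] holomorphic_vec_on_add holomorphic_vec_on_const quad lin pd_const)
  qed
  have 2: "pd j (\<lambda>t. (\<Sum>\<beta>\<in>UNIV. (a $ i $ \<beta> + a $ \<beta> $ i) * t $ \<beta>) + b $ i) = (\<lambda>t. a $ i $ j + a $ j $ i)"
    by (rule ext) (simp add: pd_add[of _ UNIV] hlin holomorphic_vec_on_const lin pd_const)
  show ?thesis unfolding 1 2 by (rule pd_const)
qed

text \<open>The Euler weight \<open>1 + \<mu> - p i\<close> is 1 where \<open>p i = \<mu>\<close>
  and \<open>1 + 2 * \<mu>\<close> where \<open>p i = - \<mu>\<close>. \<open>nonempty\<close>
  supplies the point at which the charge is determined.\<close>

locale graded_frobenius_manifold =
  fixes D :: "(complex^'n) set" and F :: "complex^'n \<Rightarrow> complex" and \<eta> :: "complex^'n^'n"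
    and e :: 'n and E :: "complex^'n \<Rightarrow> complex^'n" and d \<mu> :: complex and p :: "'n \<Rightarrow> complex"
  assumes frob: "frobenius_manifold D F \<eta> e E d" and nonempty: "D \<noteq> {}"
    and euler: "\<And>t i. E t $ i = (1 + \<mu> - p i) * t $ i"
    and p_cases: "\<And>i. p i = \<mu> \<or> p i = - \<mu>"
    and p_unit: "p e = \<mu>" and p_other: "\<exists>i. p i = - \<mu>" and \<mu>: "\<mu> \<noteq> 0"
begin

definition H where "H = matrix_inv \<eta>"
definition P :: "complex^'n^'n" where "P = (\<chi> i j. if i = j then p i else 0)"
definition F3 where "F3 \<gamma> t = (\<chi> \<nu> \<beta>. pd \<nu> (pd \<gamma> (pd \<beta> F)) t)"
definition dF3 where "dF3 \<gamma> \<delta> t = (\<chi> \<nu> \<beta>. pd \<delta> (pd \<nu> (pd \<gamma> (pd \<beta> F))) t)"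
text \<open>The lower-index form of \<open>U\<close>, symmetric on \<open>D\<close>.\<close>

definition G where "G t = (\<chi> \<nu> \<beta>. \<Sum>\<mu>'\<in>UNIV. (1 + \<mu> - p \<mu>') * t $ \<mu>' * pd \<nu> (pd \<mu>' (pd \<beta> F)) t)"

abbreviation "C \<gamma> t \<equiv> H ** F3 \<gamma> t"
abbreviation "U \<equiv> euler_mult F \<eta> E"

lemma open_D: "open D" and F_hol: "holomorphic_vec_on F D"
  and \<eta>: "transpose \<eta> = \<eta>" "invertible \<eta>"
  using frob unfolding frobenius_manifold_def by auto

lemma H: "H ** \<eta> = mat 1" "\<eta> ** H = mat 1" "transpose H = H" "invertible H"
  using invertible_matrix_inv[OF \<eta>(2)] transpose_matrix_inv[OF \<eta>(2,1)] matrix_inv_eqI(2)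
  unfolding H_def by auto

lemma pd_hol: "holomorphic_vec_on (pd i F) D" "holomorphic_vec_on (pd j (pd i F)) D"
  "holomorphic_vec_on (pd k (pd j (pd i F))) D"
  using holomorphic_vec_pd(1)[OF open_D] F_hol by blast+

lemma pd_swap:
  assumes "t \<in> D"
  shows "pd k (pd i (pd j F)) t = pd k (pd j (pd i F)) t"
    and "pd i (pd j (pd k F)) t = pd j (pd i (pd k F)) t"
    and "pd l (pd i (pd j (pd k F))) t = pd l (pd j (pd i (pd k F))) t"
    and "pd i (pd j (pd k (pd l F))) t = pd j (pd i (pd k (pd l F))) t"
proof -
  note sw = holomorphic_vec_pd(2)[OF open_D]
  have 1: "pd i (pd j F) t = pd j (pd i F) t" if "t \<in> D" for i j t
    using sw[OF F_hol that] .
  then have 2: "pd k (pd i (pd j F)) t = pd k (pd j (pd i F)) t" if "t \<in> D" for i j k t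
    by (rule pd_cong_open[OF open_D that])
  have 3: "pd i (pd j (pd k F)) t = pd j (pd i (pd k F)) t" if "t \<in> D" for i j k t
    using sw[OF pd_hol(1) that] .
  show "pd k (pd i (pd j F)) t = pd k (pd j (pd i F)) t"
    "pd i (pd j (pd k F)) t = pd j (pd i (pd k F)) t"
    "pd i (pd j (pd k (pd l F))) t = pd j (pd i (pd k (pd l F))) t"
    using 1 2 3 sw[OF pd_hol(2)] assms by blast+
  show "pd l (pd i (pd j (pd k F))) t = pd l (pd j (pd i (pd k F))) t"
    by (rule pd_cong_open[OF open_D assms 3])
qed

text \<open>Three applications of \<open>euler_homogeneity_pd\<close> reduce the degree
  \<open>3 - d\<close> by three weights, and the quadratic polynomial disappears.\<close>

lemma homogeneity:
  assumes "t \<in> D"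
  shows "(\<Sum>\<nu>\<in>UNIV. (1 + \<mu> - p \<nu>) * t $ \<nu> * pd \<nu> (pd k (pd j (pd i F))) t) =
    (- d - 3 * \<mu> + p i + p j + p k) * pd k (pd j (pd i F)) t"
proof -
  obtain a :: "complex^'n^'n" and b :: "complex^'n" and c where
    q: "\<And>t. t \<in> D \<Longrightarrow> (\<Sum>\<alpha>\<in>UNIV. E t $ \<alpha> * pd \<alpha> F t) = (3 - d) * F t +
         ((\<Sum>\<alpha>\<in>UNIV. \<Sum>\<beta>\<in>UNIV. a $ \<alpha> $ \<beta> * t $ \<alpha> * t $ \<beta>) + (\<Sum>\<alpha>\<in>UNIV. b $ \<alpha> * t $ \<alpha>) + c)"
    using frob unfolding frobenius_manifold_def by blast
  define q where "q t = (\<Sum>\<alpha>\<in>UNIV. \<Sum>\<beta>\<in>UNIV. a $ \<alpha> $ \<beta> * t $ \<alpha> * t $ \<beta>) + (\<Sum>\<alpha>\<in>UNIV. b $ \<alpha> * t $ \<alpha>) + c" for t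
  have q_hol: "holomorphic_vec_on q D"
    unfolding q_def by (intro holomorphic_vec_intros)
  have 0: "(\<Sum>\<nu>\<in>UNIV. (1 + \<mu> - p \<nu>) * t $ \<nu> * pd \<nu> F t) = (3 - d) * F t + q t" if "t \<in> D" for t
    using q[OF that] unfolding q_def euler .
  note pq = holomorphic_vec_pd(1)[OF open_D]
  note 1 = euler_homogeneity_pd[OF open_D F_hol q_hol 0]
  note 2 = euler_homogeneity_pd[OF open_D pd_hol(1) pq[OF q_hol] 1]
  note 3 = euler_homogeneity_pd[OF open_D pd_hol(2) pq[OF pq[OF q_hol]] 2]
  have "pd k (pd j (pd i q)) t = 0"
    using third_pd_quadratic[of k j i a b c t] unfolding q_def .
  then show ?thesis using 3[of t k j i] assms by (simp add: algebra_simps)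
qed

text \<open>Third derivatives involving the unit direction are the constants \<eta>, so their Euler
  derivative is zero; by \<open>homogeneity\<close> a nonzero entry must have total degree
  zero.\<close>

lemma \<eta>_graded: assumes "\<eta> $ \<alpha> $ \<beta> \<noteq> 0" shows "p \<alpha> + p \<beta> = d + 2 * \<mu>"
proof -
  obtain t where t: "t \<in> D" using nonempty by blast
  have e: "pd e (pd \<alpha> (pd \<beta> F)) s = \<eta> $ \<alpha> $ \<beta>" if "s \<in> D" for s
    using frob that unfolding frobenius_manifold_def by blast
  have "pd \<nu> (pd e (pd \<alpha> (pd \<beta> F))) t = 0" for \<nu>
    using pd_cong_open[OF open_D t e] by (simp add: pd_const)
  then have "(- d - 3 * \<mu> + p \<beta> + p \<alpha> + p e) * \<eta> $ \<alpha> $ \<beta> = 0"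
    using homogeneity[OF t, of e \<alpha> \<beta>] e[OF t] by simp
  then have "- d - 3 * \<mu> + p \<beta> + p \<alpha> + p e = 0" using assms by simp
  then show ?thesis using p_unit by (simp add: algebra_simps)
qed

text \<open>Nondegeneracy pairs every weight with another one; as both weights occur and \<open>\<mu> \<noteq> 0\<close>,
  only the pairing of opposite weights is possible, which fixes the charge.\<close>

lemma charge: "d = - 2 * \<mu>"
proof -
  have row: "\<exists>\<beta>. \<eta> $ \<alpha> $ \<beta> \<noteq> 0" for \<alpha>
  proof (rule ccontr)
    assume "\<not> ?thesis"
    then have "(\<eta> ** H) $ \<alpha> $ \<alpha> = 0" by (simp add: matrix_matrix_mult_def)
    then show False by (simp add: H mat_def)
  qed
  obtain i where i: "p i = - \<mu>" using p_other by blast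
  obtain \<beta> \<beta>' where "p e + p \<beta> = d + 2 * \<mu>" "p i + p \<beta>' = d + 2 * \<mu>"
    using row[of e] row[of i] \<eta>_graded by blast
  then show ?thesis
    using p_cases[of \<beta>] p_cases[of \<beta>'] p_unit i \<mu> by (auto simp: algebra_simps eq_neg_iff_add_eq_0)
qed

lemma P_mult: "(A ** P) $ i $ j = A $ i $ j * p j" "(P ** A) $ i $ j = p i * A $ i $ j"
  by (simp_all add: P_def matrix_matrix_mult_def if_distrib[of "\<lambda>x. _ * x"] if_distrib[of "\<lambda>x. x * _"] cong: if_cong)

text \<open>With \<open>d = - 2 * \<mu>\<close> the matrix \<eta> pairs only opposite weights, so it
  anticommutes with \<open>P\<close>; multiplying by \<open>H\<close> on both sides carries this
  over to the inverse.\<close>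

lemma HP: "H ** P = - (P ** H)"
proof -
  have "\<eta> $ \<alpha> $ \<beta> * p \<beta> = - (p \<alpha> * \<eta> $ \<alpha> $ \<beta>)" for \<alpha> \<beta>
  proof (cases "\<eta> $ \<alpha> $ \<beta> = 0")
    case False
    then have "p \<beta> = - p \<alpha>"
      using \<eta>_graded charge by (simp add: eq_neg_iff_add_eq_0 add.commute)
    then show ?thesis by simp
  qed simp
  then have "\<eta> ** P = - (P ** \<eta>)"
    by (simp add: vec_eq_iff P_mult)
  then have "H ** (\<eta> ** P) ** H = H ** (- (P ** \<eta>)) ** H" by simp
  moreover have "H ** (\<eta> ** P) ** H = P ** H"
    by (simp add: matrix_mul_assoc H)
  moreover have "H ** (- (P ** \<eta>)) ** H = - (H ** P)"
    by (simp add: matrix_uminus_left matrix_uminus_right matrix_mul_assoc[symmetric] H)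
  ultimately show ?thesis by simp
qed

lemma transpose_P: "transpose P = P"
  by (auto simp: P_def transpose_def vec_eq_iff)

lemma P_sq: "P ** P = cscale (\<mu>^2) (mat 1)"
proof -
  have "p i * p i = \<mu>^2" for i using p_cases[of i] by (auto simp: power2_eq_square)
  then show ?thesis by (auto simp: vec_eq_iff P_mult) (auto simp: P_def mat_def)
qed

lemma C_nth: "C \<gamma> t $ \<alpha> $ \<beta> = structure_const F \<eta> t \<alpha> \<gamma> \<beta>"
  by (simp add: structure_const_def F3_def H_def matrix_matrix_mult_def)

lemma U_eq: "U t = H ** G t"
proof -
  have "U t $ \<alpha> $ \<beta> = (H ** G t) $ \<alpha> $ \<beta>" for \<alpha> \<beta>
    unfolding euler_mult_def structure_const_def G_def H_def matrix_matrix_mult_def euler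
    by (simp add: sum_distrib_left mult_ac) (subst sum.swap, simp)
  then show ?thesis by (simp add: vec_eq_iff)
qed

lemma F3_sym: "t \<in> D \<Longrightarrow> transpose (F3 \<gamma> t) = F3 \<gamma> t"
  using pd_swap(1,2) by (simp add: F3_def transpose_def vec_eq_iff)

lemma G_sym: "t \<in> D \<Longrightarrow> transpose (G t) = G t"
proof -
  assume t: "t \<in> D"
  have "pd \<nu> (pd \<gamma> (pd \<beta> F)) t = pd \<beta> (pd \<gamma> (pd \<nu> F)) t" for \<nu> \<gamma> \<beta>
    by (rule trans[OF pd_swap(1)[OF t] trans[OF pd_swap(2)[OF t] pd_swap(1)[OF t]]])
  then show ?thesis by (simp add: G_def transpose_def vec_eq_iff)
qed

lemma self_adjoint: "transpose A = A \<Longrightarrow> H ** transpose (H ** A) = H ** A ** H"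
  by (simp add: matrix_transpose_mul H matrix_mul_assoc)

lemma dF3: "t \<in> D \<Longrightarrow> has_matrix_pd (F3 \<gamma>) (dF3 \<gamma> \<delta> t) \<delta> t"
  unfolding has_matrix_pd_def F3_def dF3_def
  using holomorphic_vec_line_derivative_0[OF pd_hol(3)] by simp

text \<open>The coordinate factor contributes the weight \<open>1 + \<mu> - p \<gamma>\<close>,
  homogeneity the rest. With the value of \<open>d\<close> the dependence on
  \<open>p \<gamma>\<close> drops out and the factor \<open>1 + p \<nu> + p \<beta>\<close> remains,
  which the terms with \<open>P\<close> express.\<close>

lemma dG:
  assumes t: "t \<in> D"
  shows "has_matrix_pd G (F3 \<gamma> t + P ** F3 \<gamma> t + F3 \<gamma> t ** P) \<gamma> t"
proof -
  have sw: "pd \<gamma> (pd \<nu> (pd \<kappa> (pd \<beta> F))) t = pd \<kappa> (pd \<gamma> (pd \<nu> (pd \<beta> F))) t" for \<nu> \<kappa> \<beta>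
    by (rule trans[OF pd_swap(3)[OF t] pd_swap(4)[OF t]])
  have "((\<lambda>z. G (t + z *s axis \<gamma> 1) $ \<nu> $ \<beta>) has_field_derivative pd \<gamma> (\<lambda>t. G t $ \<nu> $ \<beta>) t) (at 0)" for \<nu> \<beta>
  proof (rule holomorphic_vec_line_derivative_0[OF _ t])
    show "holomorphic_vec_on (\<lambda>t. G t $ \<nu> $ \<beta>) D"
      unfolding G_def by simp (intro holomorphic_vec_intros pd_hol)
  qed
  moreover have "pd \<gamma> (\<lambda>t. G t $ \<nu> $ \<beta>) t = (F3 \<gamma> t + P ** F3 \<gamma> t + F3 \<gamma> t ** P) $ \<nu> $ \<beta>" for \<nu> \<beta>
  proof -
    have "pd \<gamma> (\<lambda>t. G t $ \<nu> $ \<beta>) t = (1 + p \<nu> + p \<beta>) * pd \<nu> (pd \<gamma> (pd \<beta> F)) t"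
      unfolding G_def vec_lambda_beta pd_weighted_sum[OF pd_hol(3) t] sw homogeneity[OF t]
        pd_swap(2)[OF t, of \<gamma> \<nu>]
      by (simp add: charge algebra_simps)
    then show ?thesis by (simp add: P_mult F3_def algebra_simps)
  qed
  ultimately show ?thesis unfolding has_matrix_pd_def by simp
qed

text \<open>Raising the index in \<open>dG\<close> moves \<open>H\<close> past \<open>P\<close>,
  which changes the sign of the left term by \<open>HP\<close>.\<close>

lemma dU: "t \<in> D \<Longrightarrow> has_matrix_pd U (C \<gamma> t - P ** C \<gamma> t + C \<gamma> t ** P) \<gamma> t"
  unfolding U_eq[abs_def]
  by (rule has_matrix_pd_eq_rhs, rule has_matrix_pd_mult[OF has_matrix_pd_const dG])
     (simp_all add: matrix_ring_simps matrix_mul_assoc HP)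

section \<open>Commuting multiplication operators\<close>

lemma C_lower: "t \<in> D \<Longrightarrow> C \<gamma> t $ \<alpha> $ \<beta> = C \<beta> t $ \<alpha> $ \<gamma>"
  unfolding C_nth structure_const_def using pd_swap(1) by (intro sum.cong) auto

text \<open>Associativity and commutativity give u (v w) = v (u w). Arbitrary vectors cover
  multiplication by the coordinate fields and by the Euler field at once.\<close>

lemma mult_commute:
  assumes t: "t \<in> D"
  defines "M \<equiv> \<lambda>u. \<chi> \<gamma> \<beta>. \<Sum>\<alpha>\<in>UNIV. structure_const F \<eta> t \<gamma> \<alpha> \<beta> * u $ \<alpha>"
  shows "M u ** M v = M v ** M u"
proof -
  have M: "frob_mult F \<eta> t u v = M u *v v" for u v
    unfolding frob_mult_def M_def matrix_vector_mult_def
    by (simp add: sum_distrib_right) (subst sum.swap, simp)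
  have comm: "frob_mult F \<eta> t u v = frob_mult F \<eta> t v u" for u v
    unfolding frob_mult_def using C_lower[OF t] unfolding C_nth
    by (subst sum.swap) (simp add: vec_eq_iff mult_ac)
  have assoc: "frob_mult F \<eta> t (frob_mult F \<eta> t u v) w = frob_mult F \<eta> t u (frob_mult F \<eta> t v w)" for u v w
    using frob t unfolding frobenius_manifold_def by blast
  have "frob_mult F \<eta> t u (frob_mult F \<eta> t v w) = frob_mult F \<eta> t v (frob_mult F \<eta> t u w)" for w
    by (simp only: comm[of u v] flip: assoc)
  then have "(M u ** M v) *v w = (M v ** M u) *v w" for w
    unfolding M by (simp add: matrix_vector_mul_assoc)
  then show ?thesis by (simp add: matrix_eq)
qed

lemma C_as_mult: "C \<gamma> t = (\<chi> \<alpha> \<beta>. \<Sum>\<nu>\<in>UNIV. structure_const F \<eta> t \<alpha> \<nu> \<beta> * axis \<gamma> 1 $ \<nu>)"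
  by (simp add: vec_eq_iff C_nth axis_def if_distrib[of "\<lambda>x. _ * x"] cong: if_cong)

lemma U_as_mult: "U t = (\<chi> \<alpha> \<beta>. \<Sum>\<nu>\<in>UNIV. structure_const F \<eta> t \<alpha> \<nu> \<beta> * E t $ \<nu>)"
  by (simp add: euler_mult_def mult.commute)

sublocale frobenius_pencil D H P U C "\<lambda>\<gamma> \<delta> t. H ** dF3 \<gamma> \<delta> t" "\<mu>^2"
proof
  show "open D" "invertible H" "transpose H = H" by (fact open_D H)+
  show "holomorphic_vec_on (\<lambda>t. U t $ \<alpha> $ \<beta>) D" for \<alpha> \<beta>
    unfolding U_eq matrix_matrix_mult_def G_def
    by simp (intro holomorphic_vec_intros pd_hol)
  show "H ** transpose P = - (P ** H)" by (simp add: transpose_P HP)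
  show "P ** P = cscale (\<mu>^2) (mat 1)" by (rule P_sq)
next
  fix \<gamma> \<delta> t assume t: "t \<in> D"
  show "C \<gamma> t $ \<alpha> $ \<beta> = C \<beta> t $ \<alpha> $ \<gamma>" for \<alpha> \<beta> by (rule C_lower[OF t])
  show "C \<gamma> t ** C \<delta> t = C \<delta> t ** C \<gamma> t" "C \<gamma> t ** U t = U t ** C \<gamma> t"
    unfolding C_as_mult U_as_mult by (rule mult_commute[OF t])+
  show "H ** transpose (C \<gamma> t) = C \<gamma> t ** H" "H ** transpose (U t) = U t ** H"
    unfolding U_eq by (simp_all add: self_adjoint F3_sym G_sym t)
  show "has_matrix_pd (C \<gamma>) (H ** dF3 \<gamma> \<delta> t) \<delta> t"
    using has_matrix_pd_mult[OF has_matrix_pd_const dF3[OF t]] by simp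
  show "H ** dF3 \<gamma> \<delta> t = H ** dF3 \<delta> \<gamma> t"
    unfolding dF3_def trans[OF pd_swap(3)[OF t] trans[OF pd_swap(4)[OF t] pd_swap(3)[OF t]], of \<delta> _ \<gamma>] ..
  show "has_matrix_pd U (C \<gamma> t - P ** C \<gamma> t + C \<gamma> t ** P) \<gamma> t" by (rule dU[OF t])
qed

lemma eta_tilde_eq: "eta_tilde F \<eta> E = h 1 0 0"
  and intersection_form_eq: "intersection_form F \<eta> E = h 0 1 0"
  and inverse_metric_eq: "(\<lambda>t. matrix_inv \<eta>) = h 0 0 1"
  by (simp_all add: fun_eq_iff vec_eq_iff eta_tilde_def intersection_form_def raise_metric_def h_def L_def
      H_def[symmetric] matrix_matrix_mult_def[of H] transpose_def)
    (simp add: mat_def if_distrib[of "\<lambda>x. _ * x"] cong: if_cong)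

theorem flat_and_compatible:
  assumes S: "S = {t \<in> D. invertible (U t)}"
  shows "flat_metric_on S (eta_tilde F \<eta> E)" 
    "compatible_metrics_on S (eta_tilde F \<eta> E) (\<lambda>t. matrix_inv \<eta>)"
    "compatible_metrics_on S (eta_tilde F \<eta> E) (intersection_form F \<eta> E)"
proof -
  have L: "L 1 0 0 t = U t ** U t" "L 0 1 0 t = U t" "L 0 0 1 t = mat 1" for t
    by (simp_all add: L_def)
  have "open S" using open_invertible[of 0 1 0] by (simp add: L S)
  moreover have "S \<subseteq> D" using S by blast
  moreover have "invertible (L 1 0 0 t)" "invertible (L 0 1 0 t)" "invertible (L 0 0 1 t)" if "t \<in> S" for t
    using that S unfolding L by (auto simp: invertible_det_nz det_mul)
  ultimately show "flat_metric_on S (eta_tilde F \<eta> E)" 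
    "compatible_metrics_on S (eta_tilde F \<eta> E) (\<lambda>t. matrix_inv \<eta>)"
    "compatible_metrics_on S (eta_tilde F \<eta> E) (intersection_form F \<eta> E)"
    unfolding eta_tilde_eq inverse_metric_eq intersection_form_eq
    by (simp_all add: flat_h compatible_h)
qed

end

section \<open>Reduction of the indexed Euler field to two weights\<close>

theorem lemma1:
  fixes D :: "(complex^'n) set"
    and F :: "complex^'n \<Rightarrow> complex"
    and \<eta> :: "complex^'n^'n"
    and E :: "complex^'n \<Rightarrow> complex^'n"
    and d \<mu> :: complex
    and k :: nat
    and idx :: "nat \<Rightarrow> 'n"
  assumes "CARD('n) = 2 * k"
    and "bij_betw idx {1..2 * k} UNIV"
    and "frobenius_manifold D F \<eta> (idx 1) E d"
    and "\<mu> \<noteq> 0"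
    and "\<And>t. E t = (\<Sum>\<alpha>=1..k. t $ idx \<alpha> *s axis (idx \<alpha>) 1)
               + (1 + 2 * \<mu>) *s (\<Sum>\<alpha>=k+1..2*k. t $ idx \<alpha> *s axis (idx \<alpha>) 1)"
    and "S = {t \<in> D. invertible (euler_mult F \<eta> E t)}"
  shows "flat_metric_on S (eta_tilde F \<eta> E) \<and>
    compatible_metrics_on S (eta_tilde F \<eta> E) (\<lambda>t. matrix_inv \<eta>) \<and>
    compatible_metrics_on S (eta_tilde F \<eta> E) (intersection_form F \<eta> E)"
proof (cases "D = {}")
  \<comment> \<open>All claims are vacuous on the empty set, while the locale interpreted below
    requires a point of \<open>D\<close>.\<close>
  case True
  then show ?thesis
    using assms(6)
    by (simp add: flat_metric_on_def compatible_metrics_on_def contravariant_metric_on_def holomorphic_vec_on_def)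
next
  case False
  \<comment> \<open>Chosen so that \<open>1 + \<mu> - p i\<close> is 1 on the first half of the
    indices and \<open>1 + 2 * \<mu>\<close> on the second.\<close>
  define p where "p i = (if i \<in> idx ` {1..k} then \<mu> else - \<mu>)" for i
  \<comment> \<open>The index type is nonempty, hence so are both halves: \<open>idx 1\<close> lies
    in the first and \<open>idx (k + 1)\<close> in the second.\<close>
  have k: "k \<ge> 1" using assms(1) zero_less_card_finite[where 'a='n] by linarith
  have inj: "idx i = idx j \<longleftrightarrow> i = j" if "i \<in> {1..2*k}" "j \<in> {1..2*k}" for i j
    by (rule inj_on_eq_iff[OF bij_betw_imp_inj_on[OF assms(2)] that])
  have mem: "idx j \<in> idx ` {1..k} \<longleftrightarrow> j \<le> k" if "j \<in> {1..2*k}" for j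
  proof
    assume "idx j \<in> idx ` {1..k}"
    then obtain i where "i \<in> {1..k}" "idx j = idx i" by blast
    then show "j \<le> k" using inj[OF that, of i] by simp
  qed (use that in simp)
  interpret graded_frobenius_manifold D F \<eta> "idx 1" E d \<mu> p
  proof
    show "E t $ i = (1 + \<mu> - p i) * t $ i" for t i
    proof -
      obtain j where j: "i = idx j" "j \<in> {1..2*k}"
        using assms(2) unfolding bij_betw_def by blast
      have "(\<Sum>\<alpha>\<in>A. t $ idx \<alpha> * axis (idx \<alpha>) 1 $ idx j) = (if j \<in> A then t $ idx j else 0)"
        if "A \<subseteq> {1..2*k}" for A
      proof -
        have "(\<Sum>\<alpha>\<in>A. t $ idx \<alpha> * axis (idx \<alpha>) 1 $ idx j) = (\<Sum>\<alpha>\<in>A. if j = \<alpha> then t $ idx j else 0)"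
        proof (rule sum.cong[OF refl])
          fix \<alpha> assume "\<alpha> \<in> A"
          then have "idx j = idx \<alpha> \<longleftrightarrow> j = \<alpha>" using that inj[OF j(2)] by blast
          then show "t $ idx \<alpha> * axis (idx \<alpha>) 1 $ idx j = (if j = \<alpha> then t $ idx j else 0)"
            by (auto simp: axis_def)
        qed
        then show ?thesis using finite_subset[OF that] by simp
      qed
      from this[of "{1..k}"] this[of "{k+1..2*k}"] show ?thesis
        using j(2) mem[OF j(2)] unfolding assms(5) p_def j(1)
        by (auto simp: algebra_simps)
    qed
    show "p (idx 1) = \<mu>" using k by (auto simp: p_def)
    show "\<exists>i. p i = - \<mu>" using k mem[of "k + 1"] by (intro exI[of _ "idx (k + 1)"]) (auto simp: p_def)
  qed (use False assms in \<open>auto simp: p_def\<close>)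
  show ?thesis using flat_and_compatible[OF assms(6)] by blast
qed

end
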